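(* Let $\lambda$ be a partition and write $Q_\lambda(\alpha)=\sum_{\mu\ge\lambda}C_{\lambda\mu}(\alpha)q_\mu(\alpha)$. Then for every $\mu>\lambda$, $$C_{\lambda\mu}(\alpha)=\frac{\sum_{\nu\in M_*(\mu),\ \nu\ge\lambda}C_{\lambda\nu}(\alpha)r_{\nu\mu}}{e'_\lambda(\alpha)-e'_\mu(\alpha)}.$$
   Context: $F=\mathbb{Q}(\alpha)$, $\Lambda_F=F[p_1,p_2,\dots]$ ($p_n$ power sums). For a partition $\lambda$: $l(\lambda)$ number of parts, $m_a(\lambda)$ number of parts equal to $a$, $z_\lambda=\prod_ii^{m_i(\lambda)}m_i(\lambda)!$. Dominance order $\ge$ on partitions of equal weight. Scalar product $\langle p_\lambda,p_\mu\rangle=\delta_{\lambda\mu}\alpha^{l(\lambda)}z_\lambda$. Jack $P_\lambda(\alpha)$: the pairwise orthogonal functions of the form $m_\lambda+\sum_{\mu<\lambda}c_{\lambda\mu}m_\mu$ ($m_\mu$ monomials); $Q_\lambda=\langle P_\lambda,P_\lambda\rangle^{-1}P_\lambda$. $Q_n(\alpha)=\sum_{\lambda\vdash n}\alpha^{-l(\lambda)}z_\lambda^{-1}p_\lambda$ ($Q_0=1$), $q_\lambda=Q_{\lambda_1}Q_{\lambda_2}\cdots$. $e'_\lambda(\alpha)=\frac12\alpha\sum_i\lambda_i^2-\sum_ii\lambda_i$. Moving up operator: for $i<j$ and $0<k\le\lambda_j$, $r^i_j(k).\lambda$ is the rearrangement in decreasing order of $(\lambda_1,\dots,\lambda_i+k,\dots,\lambda_j-k,\dots)$;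 $M^*(\lambda)$ is the set of all such $r^i_j(k).\lambda$, and $M_*(\mu)=\{\nu:\mu\in M^*(\nu)\}$. For $\mu=r^i_j(k).\nu$, $r_{\nu\mu}=(1+\delta_{\nu_i\nu_j})^{-1}m_{\nu_i}(\nu)(m_{\nu_j}(\nu)-\delta_{\nu_i\nu_j})(\nu_i-\nu_j+2k)$. *)

theory Defs
  imports Main "HOL-Library.Poly_Mapping" "HOL-Computational_Algebra.Polynomial"
    "HOL-Computational_Algebra.Fraction_Field"
begin

type_synonym F = "rat poly fract"

definition alpha :: F where "alpha = Fract [:0, 1:] 1"

text \<open>Lambda_F is the polynomial ring over F in the variables p_1, p_2, ...;
  a monomial is an exponent vector (a maps to the multiplicity of p_a).\<close>
type_synonym Sym = "(nat \<Rightarrow>\<^sub>0 nat) \<Rightarrow>\<^sub>0 F"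

definition const :: "F \<Rightarrow> Sym" where "const c = Poly_Mapping.single 0 c"

definition psum :: "nat \<Rightarrow> Sym" where
  "psum n = Poly_Mapping.single (Poly_Mapping.single n 1) 1"

definition is_partition :: "nat list \<Rightarrow> bool" where
  "is_partition xs \<longleftrightarrow> sorted_wrt (\<ge>) xs \<and> 0 \<notin> set xs"

definition partitions_of :: "nat \<Rightarrow> nat list set" where
  "partitions_of n = {xs. is_partition xs \<and> sum_list xs = n}"

definition dominates :: "nat list \<Rightarrow> nat list \<Rightarrow> bool" where
  "dominates mu lam \<longleftrightarrow> sum_list mu = sum_list lam \<and>
     (\<forall>k. sum_list (take k lam) \<le> sum_list (take k mu))"

definition mult :: "nat \<Rightarrow> nat list \<Rightarrow> nat" where
  "mult a xs = count_list xs a"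

definition zee :: "nat list \<Rightarrow> nat" where
  "zee xs = (\<Prod>a\<in>set xs. a ^ mult a xs * fact (mult a xs))"

definition pbasis :: "nat list \<Rightarrow> Sym" where
  "pbasis xs = prod_list (map psum xs)"

definition expo :: "nat list \<Rightarrow> (nat \<Rightarrow>\<^sub>0 nat)" where
  "expo xs = sum_list (map (\<lambda>a. Poly_Mapping.single a 1) xs)"

definition pcoeff :: "Sym \<Rightarrow> nat list \<Rightarrow> F" where
  "pcoeff f xs = Poly_Mapping.lookup f (expo xs)"

definition elen :: "(nat \<Rightarrow>\<^sub>0 nat) \<Rightarrow> nat" where
  "elen e = (\<Sum>a\<in>Poly_Mapping.keys e. Poly_Mapping.lookup e a)"

definition ezee :: "(nat \<Rightarrow>\<^sub>0 nat) \<Rightarrow> nat" where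
  "ezee e = (\<Prod>a\<in>Poly_Mapping.keys e. a ^ Poly_Mapping.lookup e a * fact (Poly_Mapping.lookup e a))"

definition inner :: "Sym \<Rightarrow> Sym \<Rightarrow> F" where
  "inner f g = (\<Sum>e\<in>Poly_Mapping.keys f. Poly_Mapping.lookup f e * Poly_Mapping.lookup g e * alpha ^ elen e * of_nat (ezee e))"

text \<open>Elements of Lambda_F: no occurrence of the (non-existent) variable p_0.\<close>
definition in_Lambda :: "Sym \<Rightarrow> bool" where
  "in_Lambda f \<longleftrightarrow> (\<forall>e\<in>Poly_Mapping.keys f. Poly_Mapping.lookup e 0 = 0)"

text \<open>R lam mu = coefficient of m_mu in p_lam = number of maps g from the parts of lam
  to the parts of mu with mu_j = sum of lam_i over g(i) = j (Macdonald I.6.9).\<close>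
definition Rcount :: "nat list \<Rightarrow> nat list \<Rightarrow> nat" where
  "Rcount lam mu = card {g. length g = length lam \<and> set g \<subseteq> {..<length mu} \<and>
      (\<forall>j<length mu. sum_list (map (\<lambda>i. lam ! i) (filter (\<lambda>i. g ! i = j) [0..<length lam])) = mu ! j)}"

definition mcoeff :: "Sym \<Rightarrow> nat list \<Rightarrow> F" where
  "mcoeff f mu = (\<Sum>lam\<in>partitions_of (sum_list mu). pcoeff f lam * of_nat (Rcount lam mu))"

definition unitriangular :: "Sym \<Rightarrow> nat list \<Rightarrow> bool" where
  "unitriangular f lam \<longleftrightarrow> in_Lambda f \<and> mcoeff f lam = 1 \<and>
     (\<forall>mu. is_partition mu \<and> mu \<noteq> lam \<and> mcoeff f mu \<noteq> 0 \<longrightarrow> dominates lam mu)"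

definition jack_family :: "(nat list \<Rightarrow> Sym) \<Rightarrow> bool" where
  "jack_family P \<longleftrightarrow>
     (\<forall>lam. is_partition lam \<longrightarrow> unitriangular (P lam) lam) \<and>
     (\<forall>lam mu. is_partition lam \<and> is_partition mu \<and> lam \<noteq> mu \<longrightarrow> inner (P lam) (P mu) = 0) \<and>
     (\<forall>lam. \<not> is_partition lam \<longrightarrow> P lam = 0)"

definition jackP :: "nat list \<Rightarrow> Sym" where
  "jackP = (THE P. jack_family P)"

definition jackQ :: "nat list \<Rightarrow> Sym" where
  "jackQ lam = const (inverse (inner (jackP lam) (jackP lam))) * jackP lam"

definition Qn :: "nat \<Rightarrow> Sym" where
  "Qn n = (\<Sum>lam\<in>partitions_of n.
      const (inverse (alpha ^ length lam) * inverse (of_nat (zee lam))) * pbasis lam)"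

definition qfun :: "nat list \<Rightarrow> Sym" where
  "qfun lam = prod_list (map Qn lam)"

definition eprime :: "nat list \<Rightarrow> F" where
  "eprime lam = alpha * of_nat (\<Sum>i<length lam. (lam ! i)^2) / 2
               - of_nat (\<Sum>i<length lam. (i + 1) * lam ! i)"

definition move :: "nat \<Rightarrow> nat \<Rightarrow> nat \<Rightarrow> nat list \<Rightarrow> nat list" where
  "move i j k lam = rev (sort (filter (\<lambda>x. x \<noteq> 0)
      (lam[i := lam ! i + k, j := lam ! j - k])))"

definition valid_move :: "nat \<Rightarrow> nat \<Rightarrow> nat \<Rightarrow> nat list \<Rightarrow> bool" where
  "valid_move i j k lam \<longleftrightarrow> i < j \<and> j < length lam \<and> 0 < k \<and> k \<le> lam ! j"

definition Mup :: "nat list \<Rightarrow> nat list set" where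
  "Mup lam = {move i j k lam | i j k. valid_move i j k lam}"

definition Mdown :: "nat list \<Rightarrow> nat list set" where
  "Mdown mu = {nu. is_partition nu \<and> mu \<in> Mup nu}"

definition rcoef :: "nat list \<Rightarrow> nat list \<Rightarrow> F" where
  "rcoef nu mu = (SOME c. \<exists>i j k. valid_move i j k nu \<and> mu = move i j k nu \<and>
     c = (let a = nu ! i; b = nu ! j; d = (if a = b then 1 else 0 :: nat) in
          inverse (1 + of_nat d) * of_nat (mult a nu) * (of_nat (mult b nu) - of_nat d)
          * (of_nat a - of_nat b + 2 * of_nat k)))"

end

theory Submission
  imports Defs
begin

text \<open>
  The functions \<open>q\<^sub>\<mu>\<close> are dual to the monomial functions, so the Jack functions are characterized by
  orthogonality together with triangularity with respect to the \<open>q\<^sub>\<mu>\<close>. Let \<open>M\<close> be the Nazarov--Sklyanin matrix with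
  diagonal entries \<open>(\<alpha> - 1) m\<close>, entries \<open>p\<^sub>r\<close> on the \<open>r\<close>-th superdiagonal and
  \<open>\<alpha> r \<partial>/\<partial>p\<^sub>r\<close> on the \<open>r\<close>-th subdiagonal. The operators
  \<open>H\<^sub>k = \<Sum>\<^sub>m\<^sub>,\<^sub>n p\<^sub>m (M\<^sup>k)\<^sub>m\<^sub>n \<alpha> n \<partial>/\<partial>p\<^sub>n\<close> are then self-adjoint, and a telescoping sum shows that they
  act on the \<open>q\<^sub>\<nu>\<close> by moving up, hence triangularly for dominance. The eigenvalue of \<open>H\<^sub>k\<close> at \<open>\<nu>\<close> is a
  polynomial in \<open>\<alpha>\<close> with leading coefficient \<open>\<Sum>\<^sub>i \<nu>\<^sub>i\<^sup>k\<^sup>+\<^sup>1\<close>, so for large \<open>k\<close> it separates all partitions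
  of a given weight. This yields the existence of the Jack functions, including orthogonality for incomparable
  partitions. Finally \<open>H\<^sub>1\<close> is, up to scaling and a shift, the Laplace--Beltrami operator with eigenvalues
  \<open>e'\<^sub>\<lambda>\<close>; it acts on \<open>q\<^sub>\<nu>\<close> with off-diagonal coefficients \<open>r\<^sub>\<nu>\<^sub>\<mu>\<close>, and comparing coefficients
  in \<open>H\<^sub>1 Q\<^sub>\<lambda>\<close> gives the recursion.
\<close>

section \<open>Power sums and the scalar product\<close>

text \<open>The obstacle is that the eigenvalues of \<open>H_1\<close> do not separate partitions:
  e' equals 9 \<alpha> - 9 for both (4,1,1) and (3,3), which are incomparable. Since
  \<open>jackP\<close> is a definite description, existence and uniqueness of a fully orthogonal
  family must be established before anything can be said about it. Distinct eigenvalues serve only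
  to construct one orthogonal family. After that, a self-adjoint triangular operator has this family
  as eigenvectors whatever coincidences occur among its eigenvalues, and this is how
  \<open>H_1\<close> enters. The diagonal (\<alpha> - 1) m of the matrix is tuned: when the matrix
  meets a product of functions \<open>Qn\<close>, the contributions depending on m cancel. Cutting
  the matrix off at size N keeps it symmetric, and Newton's relation is complete as soon as N bounds
  the weight.\<close>

declare One_nat_def [simp del]

lemma lookup_const_mult [simp]: "Poly_Mapping.lookup (const c * f) e = c * Poly_Mapping.lookup f e"
  unfolding const_def mult_map_scale_conv_mult[symmetric] Poly_Mapping.map.rep_eq
  by (simp add: when_def)

lemma const_0 [simp]: "const 0 = 0" and const_1 [simp]: "const 1 = 1"
  by (simp_all add: const_def)

lemma const_add: "const (a + b) = const a + const b"
  by (simp add: const_def single_add)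

lemma const_diff: "const (a - b) = const a - const b"
  by (simp add: const_def single_diff)

lemma const_uminus: "const (- a) = - const a"
  by (simp add: const_def single_uminus)

lemma const_mult: "const (a * b) = const a * const b"
  by (simp add: const_def mult_single)

lemma const_of_nat: "const (of_nat n) = of_nat n"
  by (simp add: const_def)

lemma const_sum: "const (sum f A) = (\<Sum>x\<in>A. const (f x))"
  by (induction A rule: infinite_finite_induct) (simp_all add: const_add)

global_interpretation sym: vector_space "\<lambda>c f. const c * f"
  by unfold_locales (simp_all add: const_add const_mult algebra_simps)

text \<open>The field is ordered by the sign of leading coefficients. Positivity of \<alpha> makes
  the scalar product positive definite, so that functions can be shown to vanish through their
  square norm.\<close>

lemma alpha_pos: "alpha > 0"
  by (simp add: alpha_def zero_less_Fract_iff less_poly_def pos_poly_def)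

lemma alpha_nonzero [simp]: "alpha \<noteq> 0"
  using alpha_pos by simp

text \<open>The scalar square \<open>\<alpha>\<^bsup>l(\<lambda>)\<^esup> z\<^sub>\<lambda>\<close> of \<open>p\<^sub>\<lambda>\<close>.\<close>
definition pnorm :: "(nat \<Rightarrow>\<^sub>0 nat) \<Rightarrow> F" where
  "pnorm e = alpha ^ elen e * of_nat (ezee e)"

definition edeg :: "(nat \<Rightarrow>\<^sub>0 nat) \<Rightarrow> nat" where
  "edeg e = (\<Sum>a\<in>Poly_Mapping.keys e. a * Poly_Mapping.lookup e a)"

lemma keys_single_plus: "Poly_Mapping.keys (Poly_Mapping.single n (1::nat) + e) = insert n (Poly_Mapping.keys e)"
  by (auto simp: in_keys_iff lookup_add lookup_single when_def split: if_splits)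

lemma lookup_single_plus:
  "Poly_Mapping.lookup (Poly_Mapping.single n (1::nat) + e) a = Poly_Mapping.lookup e a + (if a = n then 1 else 0)"
  by (simp add: lookup_add lookup_single when_def)

lemma edeg_superset: "\<lbrakk>finite A; Poly_Mapping.keys e \<subseteq> A\<rbrakk> \<Longrightarrow> edeg e = (\<Sum>a\<in>A. a * Poly_Mapping.lookup e a)"
  unfolding edeg_def by (rule sum.mono_neutral_left) (auto simp: in_keys_iff)

lemma elen_superset: "\<lbrakk>finite A; Poly_Mapping.keys e \<subseteq> A\<rbrakk> \<Longrightarrow> elen e = (\<Sum>a\<in>A. Poly_Mapping.lookup e a)"
  unfolding elen_def by (rule sum.mono_neutral_left) (auto simp: in_keys_iff)

lemma ezee_superset: "\<lbrakk>finite A; Poly_Mapping.keys e \<subseteq> A\<rbrakk> \<Longrightarrow>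
  ezee e = (\<Prod>a\<in>A. a ^ Poly_Mapping.lookup e a * fact (Poly_Mapping.lookup e a))"
  unfolding ezee_def by (rule prod.mono_neutral_left) (auto simp: in_keys_iff)

lemma edeg_add: "edeg (e + e') = edeg e + edeg e'"
proof -
  let ?A = "Poly_Mapping.keys e \<union> Poly_Mapping.keys e'"
  have "edeg (e + e') = (\<Sum>a\<in>?A. a * Poly_Mapping.lookup (e + e') a)"
    by (rule edeg_superset) (simp_all add: keys_add)
  also have "\<dots> = (\<Sum>a\<in>?A. a * Poly_Mapping.lookup e a) + (\<Sum>a\<in>?A. a * Poly_Mapping.lookup e' a)"
    by (simp add: lookup_add sum.distrib algebra_simps)
  finally show ?thesis
    using edeg_superset[of ?A e] edeg_superset[of ?A e'] by simp
qed

lemma edeg_single [simp]: "edeg (Poly_Mapping.single n k) = n * k"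
  by (simp add: edeg_def)

lemma edeg_0 [simp]: "edeg 0 = 0"
  by (simp add: edeg_def)

lemma elen_single_plus: "elen (Poly_Mapping.single n 1 + e) = Suc (elen e)"
proof -
  let ?A = "insert n (Poly_Mapping.keys e)"
  have "elen (Poly_Mapping.single n 1 + e) = (\<Sum>a\<in>?A. Poly_Mapping.lookup e a + (if a = n then 1 else 0))"
    by (subst elen_superset[of ?A]) (auto simp: keys_single_plus lookup_single_plus)
  also have "\<dots> = (\<Sum>a\<in>?A. Poly_Mapping.lookup e a) + 1"
    by (subst sum.distrib) simp
  also have "(\<Sum>a\<in>?A. Poly_Mapping.lookup e a) = elen e"
    by (rule elen_superset[symmetric]) auto
  finally show ?thesis
    by simp
qed

lemma ezee_single_plus:
  "ezee (Poly_Mapping.single n 1 + e) = n * Suc (Poly_Mapping.lookup e n) * ezee e"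
proof -
  let ?A = "insert n (Poly_Mapping.keys e)"
  have "ezee (Poly_Mapping.single n 1 + e) =
      (\<Prod>a\<in>?A. a ^ Poly_Mapping.lookup e a * fact (Poly_Mapping.lookup e a)
         * (if a = n then n * Suc (Poly_Mapping.lookup e n) else 1))"
    by (subst ezee_superset[of ?A])
       (auto simp: keys_single_plus lookup_single_plus distrib_left distrib_right mult_ac
          simp flip: Suc_eq_plus1 simp del: prod.insert intro!: prod.cong)
  also have "\<dots> = (\<Prod>a\<in>?A. a ^ Poly_Mapping.lookup e a * fact (Poly_Mapping.lookup e a))
      * (n * Suc (Poly_Mapping.lookup e n))"
    by (subst prod.distrib) (simp del: prod.insert)
  also have "(\<Prod>a\<in>?A. a ^ Poly_Mapping.lookup e a * fact (Poly_Mapping.lookup e a)) = ezee e"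
    by (rule ezee_superset[symmetric]) auto
  finally show ?thesis
    by simp
qed

lemma pnorm_single_plus:
  "pnorm (Poly_Mapping.single n 1 + e) = alpha * of_nat n * (of_nat (Poly_Mapping.lookup e n) + 1) * pnorm e"
  unfolding pnorm_def elen_single_plus ezee_single_plus by (simp add: algebra_simps)

lemma pnorm_pos: "Poly_Mapping.lookup e 0 = 0 \<Longrightarrow> pnorm e > 0"
  by (auto simp: pnorm_def ezee_def alpha_pos in_keys_iff intro!: mult_pos_pos prod_pos zero_less_power)
     (metis gr0I)

lemma inner_superset:
  "\<lbrakk>finite A; Poly_Mapping.keys f \<subseteq> A\<rbrakk> \<Longrightarrow>
   inner f g = (\<Sum>e\<in>A. Poly_Mapping.lookup f e * Poly_Mapping.lookup g e * pnorm e)"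
  unfolding inner_def pnorm_def mult.assoc
  by (rule sum.mono_neutral_left) (auto simp: in_keys_iff)

lemma inner_commute: "inner f g = inner g f"
proof -
  let ?A = "Poly_Mapping.keys f \<union> Poly_Mapping.keys g"
  show ?thesis
    by (subst (1 2) inner_superset[of ?A]) (auto simp: mult_ac)
qed

lemma inner_add_left: "inner (f + g) h = inner f h + inner g h"
proof -
  let ?A = "Poly_Mapping.keys f \<union> Poly_Mapping.keys g"
  have "Poly_Mapping.keys (f + g) \<subseteq> ?A"
    by (rule keys_add)
  then show ?thesis
    by (subst (1 2 3) inner_superset[of ?A]) (auto simp: lookup_add sum.distrib algebra_simps)
qed

lemma inner_scale_left: "inner (const c * f) g = c * inner f g"
proof -
  have "Poly_Mapping.keys (const c * f) \<subseteq> Poly_Mapping.keys f"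
    by (auto simp: in_keys_iff)
  then show ?thesis
    by (subst (1 2) inner_superset[of "Poly_Mapping.keys f"]) (auto simp: sum_distrib_left mult.assoc)
qed

lemma inner_0_left [simp]: "inner 0 g = 0"
  by (simp add: inner_def)

lemma inner_sum_left: "inner (sum f A) g = (\<Sum>x\<in>A. inner (f x) g)"
  by (induction A rule: infinite_finite_induct) (simp_all add: inner_add_left)

lemma inner_diff_left: "inner (f - g) h = inner f h - inner g h"
  using inner_add_left[of "f - g" g h] by simp

lemma inner_0_right [simp]: "inner g 0 = 0"
  by (subst inner_commute) simp

lemma inner_add_right: "inner h (f + g) = inner h f + inner h g"
  by (subst (1 2 3) inner_commute) (rule inner_add_left)

lemma inner_diff_right: "inner h (f - g) = inner h f - inner h g"
  by (subst (1 2 3) inner_commute) (rule inner_diff_left)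

lemma inner_scale_right: "inner g (const c * f) = c * inner g f"
  by (subst (1 2) inner_commute) (rule inner_scale_left)

lemma inner_sum_right: "inner g (sum f A) = (\<Sum>x\<in>A. inner g (f x))"
  by (subst inner_commute, subst inner_sum_left, simp only: inner_commute)

lemma inner_single_right: "inner f (Poly_Mapping.single e c) = Poly_Mapping.lookup f e * c * pnorm e"
  by (subst inner_commute, subst inner_superset[of "{e}"]) (auto simp: mult_ac)

text \<open>The square norm is a sum of squares with positive weights in an ordered field.
  Membership in \<open>in_Lambda\<close> matters: a variable p_0 would put a factor 0 into
  \<open>ezee\<close> and make the weight vanish.\<close>

lemma inner_self_eq_0:
  assumes "in_Lambda f" "inner f f = 0"
  shows "f = 0"
proof (rule ccontr)
  assume "f \<noteq> 0"
  then have "Poly_Mapping.keys f \<noteq> {}"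
    by auto
  then have "(\<Sum>e\<in>Poly_Mapping.keys f. Poly_Mapping.lookup f e * Poly_Mapping.lookup f e * pnorm e) > 0"
  proof (intro sum_pos)
    fix e assume "e \<in> Poly_Mapping.keys f"
    with assms(1) have "pnorm e > 0" "Poly_Mapping.lookup f e \<noteq> 0"
      by (auto simp: in_Lambda_def intro: pnorm_pos)
    then show "Poly_Mapping.lookup f e * Poly_Mapping.lookup f e * pnorm e > 0"
      by (simp add: zero_less_mult_iff) (use neq_iff in blast)
  qed auto
  with assms(2) show False
    by (subst (asm) inner_superset[of "Poly_Mapping.keys f"]) auto
qed

text \<open>The adjoint \<open>\<alpha> n \<partial>/\<partial>p\<^sub>n\<close> of multiplication by \<open>p\<^sub>n\<close>.\<close>
definition perp :: "nat \<Rightarrow> Sym \<Rightarrow> Sym" where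
  "perp n f = Poly_Mapping.mapp (\<lambda>e c. alpha * of_nat n * (of_nat (Poly_Mapping.lookup e n) + 1) * c)
     (Poly_Mapping.map_key (\<lambda>e. Poly_Mapping.single n 1 + e) f)"

lemma lookup_perp: "Poly_Mapping.lookup (perp n f) e =
  alpha * of_nat n * (of_nat (Poly_Mapping.lookup e n) + 1) * Poly_Mapping.lookup f (Poly_Mapping.single n 1 + e)"
proof -
  have "inj (\<lambda>e. Poly_Mapping.single n (1::nat) + e)"
    by (rule injI) simp
  then show ?thesis
    by (simp add: perp_def lookup_mapp map_key.rep_eq when_def in_keys_iff)
qed

lemma perp_add: "perp n (f + g) = perp n f + perp n g"
  by (rule poly_mapping_eqI) (simp add: lookup_perp lookup_add algebra_simps)

lemma perp_scale: "perp n (const c * f) = const c * perp n f"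
  by (rule poly_mapping_eqI) (simp add: lookup_perp)

lemma perp_0 [simp]: "perp n 0 = 0"
  by (rule poly_mapping_eqI) (simp add: lookup_perp)

lemma perp_sum: "perp n (sum f A) = (\<Sum>x\<in>A. perp n (f x))"
  by (induction A rule: infinite_finite_induct) (simp_all add: perp_add)

lemma perp_single: "perp n (Poly_Mapping.single e c) =
  Poly_Mapping.single (e - Poly_Mapping.single n 1) (alpha * of_nat n * of_nat (Poly_Mapping.lookup e n) * c)"
proof (rule poly_mapping_eqI)
  fix e'
  show "Poly_Mapping.lookup (perp n (Poly_Mapping.single e c)) e' =
    Poly_Mapping.lookup (Poly_Mapping.single (e - Poly_Mapping.single n 1)
       (alpha * of_nat n * of_nat (Poly_Mapping.lookup e n) * c)) e'"
  proof (cases "Poly_Mapping.lookup e n = 0")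
    case True
    then have "e \<noteq> Poly_Mapping.single n 1 + e'"
      by (auto simp: lookup_add)
    with True show ?thesis
      by (simp add: lookup_perp lookup_single)
  next
    case False
    have "e = Poly_Mapping.single n 1 + e' \<longleftrightarrow> e - Poly_Mapping.single n 1 = e'"
    proof
      assume "e - Poly_Mapping.single n 1 = e'"
      with False show "e = Poly_Mapping.single n 1 + e'"
        by (auto intro!: poly_mapping_eqI simp: lookup_add lookup_minus lookup_single when_def)
    qed auto
    then show ?thesis
      by (auto simp: lookup_perp lookup_single lookup_add)
  qed
qed

lemma Sym_as_sum: "f = (\<Sum>e\<in>Poly_Mapping.keys f. Poly_Mapping.single e (Poly_Mapping.lookup f e))"
  by (rule poly_mapping_eqI) (auto simp: lookup_sum lookup_single when_def in_keys_iff)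

lemma perp_mult: "perp n (f * g) = perp n f * g + f * perp n g"
proof -
  have single: "perp n (Poly_Mapping.single e c * Poly_Mapping.single e' c') =
      perp n (Poly_Mapping.single e c) * Poly_Mapping.single e' c' +
      Poly_Mapping.single e c * perp n (Poly_Mapping.single e' c')" (is "?l = ?r") for e e' c c'
  proof -
    have l: "?l = Poly_Mapping.single (e + e' - Poly_Mapping.single n 1)
      (alpha * of_nat n * of_nat (Poly_Mapping.lookup e n) * (c * c')) +
      Poly_Mapping.single (e + e' - Poly_Mapping.single n 1)
      (alpha * of_nat n * of_nat (Poly_Mapping.lookup e' n) * (c * c'))"
      by (simp add: mult_single perp_single lookup_add algebra_simps flip: single_add)
    have "e - Poly_Mapping.single n 1 + e' = e + e' - Poly_Mapping.single n 1"
      if "Poly_Mapping.lookup e n \<noteq> 0" for e e' :: "nat \<Rightarrow>\<^sub>0 nat"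
      using that by (auto intro!: poly_mapping_eqI simp: lookup_add lookup_minus lookup_single when_def)
    \<comment> \<open>Truncated subtraction gives a wrong exponent only if p_n does not occur in e,
      and then the coefficient is zero.\<close>
    then have "Poly_Mapping.single (e - Poly_Mapping.single n 1 + e') (of_nat (Poly_Mapping.lookup e n) * d) =
      Poly_Mapping.single (e + e' - Poly_Mapping.single n 1) (of_nat (Poly_Mapping.lookup e n) * d)"
      for e e' :: "nat \<Rightarrow>\<^sub>0 nat" and d :: F
      by (cases "Poly_Mapping.lookup e n = 0") auto
    from this[of e e' "alpha * of_nat n * (c * c')"] this[of e' e "alpha * of_nat n * (c * c')"]
    show ?thesis
      unfolding l by (simp add: perp_single mult_single mult_ac add.commute)
  qed
  have "perp n (f * g) =
    (\<Sum>e\<in>Poly_Mapping.keys f. \<Sum>e'\<in>Poly_Mapping.keys g.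
       perp n (Poly_Mapping.single e (Poly_Mapping.lookup f e) * Poly_Mapping.single e' (Poly_Mapping.lookup g e')))"
    by (subst (1) Sym_as_sum[of f], subst (1) Sym_as_sum[of g]) (simp add: sum_product perp_sum)
  also have "\<dots> = (\<Sum>e\<in>Poly_Mapping.keys f. perp n (Poly_Mapping.single e (Poly_Mapping.lookup f e))) * g +
      f * (\<Sum>e\<in>Poly_Mapping.keys g. perp n (Poly_Mapping.single e (Poly_Mapping.lookup g e)))"
    by (subst (3) Sym_as_sum[of g], subst (3) Sym_as_sum[of f]) (simp add: single sum.distrib sum_product)
  finally show ?thesis
    by (simp flip: perp_sum Sym_as_sum)
qed

text \<open>Inserting one more p_n multiplies \<open>pnorm\<close> by exactly the factor that
  differentiation produces in \<open>perp\<close>, see \<open>pnorm_single_plus\<close>.\<close>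

lemma inner_psum_mult: "inner (psum n * f) g = inner f (perp n g)"
proof -
  let ?s = "\<lambda>e. Poly_Mapping.single n (1::nat) + e"
  have inj: "inj_on ?s A" for A
    by (rule inj_onI) simp
  have f: "psum n * f = (\<Sum>e\<in>Poly_Mapping.keys f. Poly_Mapping.single (?s e) (Poly_Mapping.lookup f e))"
    by (subst (1) Sym_as_sum[of f]) (simp add: sum_distrib_left psum_def mult_single)
  have "inner (psum n * f) g =
      (\<Sum>e\<in>Poly_Mapping.keys f. Poly_Mapping.lookup g (?s e) * Poly_Mapping.lookup f e * pnorm (?s e))"
    unfolding f by (subst inner_commute) (simp add: inner_sum_right inner_single_right)
  also have "\<dots> = inner f (perp n g)"
    by (subst inner_superset[of "Poly_Mapping.keys f"])
       (auto simp: lookup_perp pnorm_single_plus mult_ac intro!: sum.cong)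
  finally show ?thesis .
qed

section \<open>Partitions and exponent vectors\<close>

definition psort :: "nat list \<Rightarrow> nat list" where
  "psort xs = rev (sort (filter (\<lambda>x. x \<noteq> 0) xs))"

lemma is_partition_psort [simp]: "is_partition (psort xs)"
  by (auto simp: psort_def is_partition_def sorted_wrt_rev)

lemma mset_psort: "mset (psort xs) = filter_mset (\<lambda>x. x \<noteq> 0) (mset xs)"
  by (simp add: psort_def)

lemma psort_eqI: "filter_mset (\<lambda>x. x \<noteq> 0) (mset xs) = filter_mset (\<lambda>x. x \<noteq> 0) (mset ys) \<Longrightarrow> psort xs = psort ys"
  unfolding psort_def by (auto intro!: properties_for_sort)

lemma psort_partition: "is_partition xs \<Longrightarrow> psort xs = xs"
proof -
  assume xs: "is_partition xs"
  then have "filter (\<lambda>x. x \<noteq> 0) xs = xs"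
    by (auto simp: is_partition_def filter_id_conv intro: gr0I)
  moreover have "sort xs = rev xs"
    using xs by (intro properties_for_sort) (auto simp: is_partition_def sorted_wrt_rev)
  ultimately show ?thesis
    by (simp add: psort_def)
qed

lemma partition_eq_iff_mset: "\<lbrakk>is_partition xs; is_partition ys\<rbrakk> \<Longrightarrow> xs = ys \<longleftrightarrow> mset xs = mset ys"
  by (metis psort_eqI psort_partition)

lemma sum_list_psort [simp]: "sum_list (psort xs) = sum_list xs"
proof -
  have "sum_list (psort xs) = sum_mset (mset (filter (\<lambda>x. x \<noteq> 0) xs))"
    unfolding sum_mset_sum_list[symmetric] by (simp add: psort_def)
  also have "\<dots> = sum_list xs"
    unfolding sum_mset_sum_list by (induction xs) auto
  finally show ?thesis .
qed

lemma psort_in_partitions_of: "psort xs \<in> partitions_of (sum_list xs)"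
  by (simp add: partitions_of_def)

lemma finite_partitions_of [simp]: "finite (partitions_of n)"
proof (rule finite_subset)
  show "partitions_of n \<subseteq> {xs. set xs \<subseteq> {..n} \<and> length xs \<le> n}"
  proof
    fix xs assume "xs \<in> partitions_of n"
    then have "0 \<notin> set xs" "sum_list xs = n"
      by (auto simp: partitions_of_def is_partition_def)
    moreover have "length xs \<le> sum_list xs" if "0 \<notin> set xs" for xs :: "nat list"
      using that by (induction xs) (auto simp: Suc_le_eq add_strict_increasing)
    ultimately show "xs \<in> {xs. set xs \<subseteq> {..n} \<and> length xs \<le> n}"
      using member_le_sum_list[of _ xs] by auto
  qed
qed (rule finite_lists_length_le, simp)

lemma expo_Nil [simp]: "expo [] = 0"
  and expo_Cons: "expo (a # xs) = Poly_Mapping.single a 1 + expo xs"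
  by (simp_all add: expo_def)

lemma lookup_expo: "Poly_Mapping.lookup (expo xs) a = count (mset xs) a"
  by (induction xs) (auto simp: expo_Cons lookup_single_plus)

lemma pbasis_eq_single: "pbasis xs = Poly_Mapping.single (expo xs) 1"
  by (induction xs) (auto simp: pbasis_def expo_Cons psum_def mult_single)

lemma edeg_expo [simp]: "edeg (expo xs) = sum_list xs"
  by (induction xs) (auto simp: expo_Cons edeg_add)

lemma elen_expo [simp]: "elen (expo xs) = length xs"
  by (induction xs) (auto simp: expo_Cons elen_single_plus, simp add: elen_def)

lemma keys_expo [simp]: "Poly_Mapping.keys (expo xs) = set xs"
  by (simp add: set_eq_iff in_keys_iff lookup_expo)

lemma ezee_expo [simp]: "ezee (expo xs) = zee xs"
  unfolding zee_def ezee_def by (simp add: lookup_expo Defs.mult_def count_mset)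

definition Eset :: "nat \<Rightarrow> (nat \<Rightarrow>\<^sub>0 nat) set" where
  "Eset n = {e. Poly_Mapping.lookup e 0 = 0 \<and> edeg e = n}"

lemma bij_betw_expo: "bij_betw expo (partitions_of n) (Eset n)"
proof (rule bij_betw_imageI)
  show "inj_on expo (partitions_of n)"
  proof (rule inj_onI)
    fix xs ys assume *: "xs \<in> partitions_of n" "ys \<in> partitions_of n" "expo xs = expo ys"
    then have "mset xs = mset ys"
      by (auto intro!: multiset_eqI simp flip: lookup_expo)
    with * show "xs = ys"
      by (auto simp: partitions_of_def partition_eq_iff_mset)
  qed
  show "expo ` partitions_of n = Eset n"
  proof (intro equalityI subsetI)
    fix e assume "e \<in> expo ` partitions_of n"
    then show "e \<in> Eset n"
      by (auto simp: partitions_of_def Eset_def is_partition_def lookup_expo)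
  next
    fix e assume e: "e \<in> Eset n"
    have "finite {x. 0 < Poly_Mapping.lookup e x}"
      using finite_lookup[of e] by simp
    then have cnt: "count (Abs_multiset (Poly_Mapping.lookup e)) = Poly_Mapping.lookup e"
      by simp
    obtain xs where xs: "mset xs = Abs_multiset (Poly_Mapping.lookup e)"
      using ex_mset by blast
    have "0 \<notin> set xs"
      using e xs cnt by (metis (mono_tags, lifting) Eset_def count_mset_0_iff mem_Collect_eq)
    then have "mset (psort xs) = mset xs"
      by (auto simp: mset_psort filter_mset_eq_conv intro: gr0I)
    then have ee: "expo (psort xs) = e"
      by (intro poly_mapping_eqI) (simp add: lookup_expo xs cnt)
    moreover have "sum_list (psort xs) = n"
      using e edeg_expo[of "psort xs"] ee by (simp add: Eset_def)
    ultimately show "e \<in> expo ` partitions_of n"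
      by (force simp: partitions_of_def)
  qed
qed

lemma finite_Eset [simp]: "finite (Eset n)"
  using bij_betw_finite[OF bij_betw_expo[of n]] by simp

lemma pnorm_expo: "pnorm (expo xs) = alpha ^ length xs * of_nat (zee xs)"
  by (simp add: pnorm_def)

section \<open>The functions \<open>Qn\<close>: derivatives and Newton's relation\<close>

lemma lookup_Qn: "Poly_Mapping.lookup (Qn n) e = (if e \<in> Eset n then inverse (pnorm e) else 0)"
proof -
  have "Qn n = (\<Sum>lam\<in>partitions_of n. Poly_Mapping.single (expo lam) (inverse (pnorm (expo lam))))"
    unfolding Qn_def by (simp add: pbasis_eq_single const_def mult_single pnorm_expo)
  also have "\<dots> = (\<Sum>e\<in>Eset n. Poly_Mapping.single e (inverse (pnorm e)))"
    by (rule sum.reindex_bij_betw[OF bij_betw_expo])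
  finally show ?thesis
    by (auto simp: lookup_sum lookup_single when_def)
qed

lemma Qn_0 [simp]: "Qn 0 = 1"
proof -
  have "xs = []" if "is_partition xs" "sum_list xs = 0" for xs
    using that by (cases xs) (auto simp: is_partition_def)
  then have "partitions_of 0 = {[]}"
    by (auto simp: partitions_of_def) (simp add: is_partition_def)
  then show ?thesis
    by (simp add: Qn_def zee_def pbasis_def)
qed

definition Qz :: "int \<Rightarrow> Sym" where
  "Qz a = (if a < 0 then 0 else Qn (nat a))"

lemma Qz_neg: "a < 0 \<Longrightarrow> Qz a = 0"
  by (simp add: Qz_def)

lemma lookup_Qz: "Poly_Mapping.lookup (Qz a) e =
  (if Poly_Mapping.lookup e 0 = 0 \<and> int (edeg e) = a then inverse (pnorm e) else 0)"
  by (auto simp: Qz_def lookup_Qn Eset_def)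

lemma of_nat_Suc_nonzero [simp]: "of_nat n + 1 \<noteq> (0 :: F)"
  by (metis of_nat_Suc of_nat_neq_0 add.commute)

lemma inverse_pnorm_single_plus:
  assumes "n \<ge> 1"
  shows "alpha * of_nat n * (of_nat (Poly_Mapping.lookup e n) + 1) * inverse (pnorm (Poly_Mapping.single n 1 + e))
    = inverse (pnorm e)"
proof -
  have "alpha * of_nat n * (of_nat (Poly_Mapping.lookup e n) + 1) \<noteq> 0"
    using assms by simp
  moreover have "c * inverse (c * p) = inverse p" if "c \<noteq> 0" for c p :: F
    using that by (simp add: mult.assoc[symmetric])
  ultimately show ?thesis
    unfolding pnorm_single_plus by blast
qed

text \<open>In the generating function exp(sum of p_n t^n / (\<alpha> n)) of the \<open>Qn\<close>,
  the operator \<alpha> n d/dp_n is multiplication by t^n.\<close>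

lemma perp_Qz: "n \<ge> 1 \<Longrightarrow> perp n (Qz a) = Qz (a - int n)"
  by (rule poly_mapping_eqI)
     (auto simp: lookup_perp lookup_Qz lookup_single_plus edeg_add inverse_pnorm_single_plus)

lemma lookup_psum_mult: "Poly_Mapping.lookup (psum n * f) e =
  (if Poly_Mapping.lookup e n = 0 then 0 else Poly_Mapping.lookup f (e - Poly_Mapping.single n 1))"
proof -
  have f: "psum n * f = (\<Sum>e\<in>Poly_Mapping.keys f. Poly_Mapping.single (Poly_Mapping.single n 1 + e) (Poly_Mapping.lookup f e))"
    by (subst (1) Sym_as_sum[of f]) (simp add: sum_distrib_left psum_def mult_single)
  have "Poly_Mapping.single n 1 + e' = e \<longleftrightarrow> e' = e - Poly_Mapping.single n 1" if "Poly_Mapping.lookup e n \<noteq> 0" for e'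
    using that by (auto intro!: poly_mapping_eqI simp: lookup_add lookup_minus lookup_single when_def)
  moreover have "Poly_Mapping.single n 1 + e' \<noteq> e" if "Poly_Mapping.lookup e n = 0" for e'
    using that by (auto simp: lookup_add)
  ultimately show ?thesis
    unfolding f by (auto simp: lookup_sum lookup_single when_def in_keys_iff)
qed

text \<open>This is t d/dt applied to the generating function of the \<open>Qn\<close>.
  Coefficientwise: a monomial in which p_s occurs m_s times has in p_s Q_(a-s) the coefficient
  \<alpha> s m_s times its coefficient in Q_a, and the numbers s m_s add up to a. The bound on a
  ensures that no part s is missed by the sum.\<close>

lemma Newton_Qz:
  assumes "a \<le> int N"
  shows "(\<Sum>s\<in>{1..N}. psum s * Qz (a - int s)) = const (alpha * of_int a) * Qz a"
proof (rule poly_mapping_eqI)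
  fix e
  let ?L = "Poly_Mapping.lookup"
  have coeff: "?L (psum s * Qz (a - int s)) e = ?L (Qz a) e * alpha * of_nat (s * ?L e s)" if "s \<in> {1..N}" for s
  proof (cases "?L e s = 0")
    case False
    define e' where "e' = e - Poly_Mapping.single s 1"
    have e: "e = Poly_Mapping.single s 1 + e'"
      using False unfolding e'_def
      by (auto intro!: poly_mapping_eqI simp: lookup_add lookup_minus lookup_single when_def)
    have s: "s \<noteq> 0"
      using that by auto
    have "?L (psum s * Qz (a - int s)) e = ?L (Qz (a - int s)) e'"
      using False by (simp add: lookup_psum_mult e'_def)
    also have "\<dots> = ?L (Qz a) e * alpha * of_nat (s * ?L e s)"
    proof -
      have "?L e 0 = ?L e' 0" "edeg e = s + edeg e'" "?L e s = ?L e' s + 1"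
        using s by (simp_all add: e lookup_single_plus edeg_add)
      moreover have "inverse (pnorm e') = inverse (pnorm e) * alpha * of_nat (s * (?L e' s + 1))"
        using s inverse_pnorm_single_plus[of s e'] by (simp add: e mult_ac)
      ultimately show ?thesis
        unfolding lookup_Qz by auto
    qed
    finally show ?thesis .
  qed (simp add: lookup_psum_mult)
  have sum: "of_nat (\<Sum>s\<in>{1..N}. s * ?L e s) = (of_int a :: F)" if "int (edeg e) = a"
  proof -
    have "s \<le> edeg e" if "s \<in> Poly_Mapping.keys e" for s
    proof -
      have "s * 1 \<le> s * ?L e s"
        using that by (intro mult_left_mono) (auto simp: in_keys_iff Suc_le_eq One_nat_def)
      also have "\<dots> \<le> edeg e"
        unfolding edeg_def using that by (intro member_le_sum) auto
      finally show ?thesis by simp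
    qed
    with that assms have "Poly_Mapping.keys e \<subseteq> {0..N}"
      by force
    then have "edeg e = (\<Sum>s\<in>{0..N}. s * ?L e s)"
      by (intro edeg_superset) auto
    also have "\<dots> = (\<Sum>s\<in>{1..N}. s * ?L e s)"
      by (rule sum.mono_neutral_right) (auto simp: One_nat_def)
    finally show ?thesis
      using that by (metis of_int_of_nat_eq)
  qed
  have "?L (\<Sum>s\<in>{1..N}. psum s * Qz (a - int s)) e = (\<Sum>s\<in>{1..N}. ?L (Qz a) e * alpha * of_nat (s * ?L e s))"
    unfolding lookup_sum by (intro sum.cong refl coeff)
  also have "\<dots> = ?L (Qz a) e * alpha * of_nat (\<Sum>s\<in>{1..N}. s * ?L e s)"
    by (simp add: sum_distrib_left)
  also have "\<dots> = ?L (const (alpha * of_int a) * Qz a) e"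
    using sum by (auto simp: lookup_Qz)
  finally show "?L (\<Sum>s\<in>{1..N}. psum s * Qz (a - int s)) e = ?L (const (alpha * of_int a) * Qz a) e" .
qed

text \<open>Compositions are handled as integer vectors, so that removing a horizontal strip never
  truncates: products with a negative index vanish.\<close>
definition qz :: "nat \<Rightarrow> (nat \<Rightarrow> int) \<Rightarrow> Sym" where
  "qz l v = (\<Prod>i<l. Qz (v i))"

lemma qz_upd: "i < l \<Longrightarrow> qz l (v(i := x)) = Qz x * (\<Prod>j\<in>{..<l} - {i}. Qz (v j))"
  unfolding qz_def by (subst prod.remove[of _ i]) (auto intro!: arg_cong2[where f = "(*)"] prod.cong)

lemma qz_upd2: "\<lbrakk>i < l; j < l; i \<noteq> j\<rbrakk> \<Longrightarrow>
  qz l (v(i := x, j := y)) = Qz x * Qz y * (\<Prod>k\<in>{..<l} - {i, j}. Qz (v k))"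
  unfolding qz_def
  by (subst prod.remove[of _ i], simp, simp, subst prod.remove[of _ j])
     (auto intro!: prod.cong simp: mult.assoc)

lemma perp_1 [simp]: "perp n 1 = 0"
proof -
  have "perp n (Poly_Mapping.single 0 1) = 0"
    by (subst perp_single) simp
  then show ?thesis
    by simp
qed

lemma perp_prod: "finite I \<Longrightarrow> perp n (prod f I) = (\<Sum>i\<in>I. perp n (f i) * prod f (I - {i}))"
proof (induction I rule: finite_induct)
  case (insert x I)
  have "(\<Sum>i\<in>I. perp n (f i) * prod f (insert x I - {i})) = (\<Sum>i\<in>I. f x * (perp n (f i) * prod f (I - {i})))"
  proof (rule sum.cong)
    fix i assume "i \<in> I"
    with insert have "insert x I - {i} = insert x (I - {i})" "x \<notin> I - {i}"
      by auto
    with insert show "perp n (f i) * prod f (insert x I - {i}) = f x * (perp n (f i) * prod f (I - {i}))"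
      by (simp add: mult_ac)
  qed simp
  with insert show ?case
    by (simp add: perp_mult sum_distrib_left)
qed simp

lemma perp_qz: "n \<ge> 1 \<Longrightarrow> perp n (qz l v) = (\<Sum>i<l. qz l (v(i := v i - int n)))"
  unfolding qz_def[of l v]
  by (subst perp_prod) (auto simp: perp_Qz qz_upd intro!: sum.cong)

lemma qfun_eq_qz: "qfun xs = qz (length xs) (\<lambda>i. int (xs ! i))"
  unfolding qfun_def qz_def Qz_def by (simp add: prod.list_conv_set_nth atLeast0LessThan)

lemma qfun_Cons [simp]: "qfun (a # xs) = Qn a * qfun xs"
  and qfun_Nil [simp]: "qfun [] = 1"
  by (simp_all add: qfun_def)

lemma qfun_psort [simp]: "qfun (psort xs) = qfun xs"
proof -
  have "qfun (psort xs) = prod_mset (image_mset Qn (mset (psort xs)))"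
    unfolding qfun_def by (metis mset_map prod_mset_prod_list)
  also have "\<dots> = prod_mset (image_mset Qn (mset (filter (\<lambda>x. x \<noteq> 0) xs)))"
    by (simp add: psort_def)
  also have "\<dots> = qfun xs"
    by (induction xs) auto
  finally show ?thesis .
qed

lemma keys_qfun: "e \<in> Poly_Mapping.keys (qfun xs) \<Longrightarrow> e \<in> Eset (sum_list xs)"
proof (induction xs arbitrary: e)
  case (Cons a xs)
  then obtain e1 e2 where "e = e1 + e2" "e1 \<in> Poly_Mapping.keys (Qn a)" "e2 \<in> Poly_Mapping.keys (qfun xs)"
    using keys_mult[of "Qn a" "qfun xs"] by auto
  with Cons.IH[of e2] show ?case
    by (auto simp: Eset_def edeg_add lookup_add in_keys_iff lookup_Qn split: if_splits)
qed (auto simp: Eset_def)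

section \<open>The functions \<open>q\<^sub>\<lambda>\<close>\<close>

text \<open>A recursive form of the box sums in \<open>Rcount\<close>, suited to induction over the
  parts.\<close>

fun fibre_sum :: "nat \<Rightarrow> nat list \<Rightarrow> nat list \<Rightarrow> nat" where
  "fibre_sum j (x # g) (a # xs) = (if x = j then a else 0) + fibre_sum j g xs"
| "fibre_sum j _ _ = 0"

lemma fibre_sum_conv:
  "length g = length xs \<Longrightarrow>
   sum_list (map (\<lambda>i. xs ! i) (filter (\<lambda>i. g ! i = j) [0..<length xs])) = fibre_sum j g xs"
proof (induction g xs rule: list_induct2)
  case (Cons x g a xs)
  have "[0..<length (a # xs)] = 0 # map Suc [0..<length xs]"
    by (simp add: upt_conv_Cons map_Suc_upt del: upt_Suc)
  with Cons show ?case
    by (simp add: filter_map o_def)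
qed simp

text \<open>The prescribed box sums are integers, so that placing a part into a box simply lowers
  one entry of v; an entry that becomes negative leaves no filling, just as it makes
  \<open>qz\<close> vanish.\<close>

definition fillings :: "nat list \<Rightarrow> nat \<Rightarrow> (nat \<Rightarrow> int) \<Rightarrow> nat list set" where
  "fillings xs l v = {g. length g = length xs \<and> set g \<subseteq> {..<l} \<and> (\<forall>j<l. int (fibre_sum j g xs) = v j)}"

lemma Rcount_eq: "Rcount lam mu = card (fillings lam (length mu) (\<lambda>i. int (mu ! i)))"
  unfolding Rcount_def fillings_def
  by (intro arg_cong[where f = card] Collect_cong) (auto simp: fibre_sum_conv)

lemma finite_fillings [simp]: "finite (fillings xs l v)"
  by (rule finite_subset[OF _ finite_lists_length_eq[of "{..<l}" "length xs"]]) (auto simp: fillings_def)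

lemma fillings_Cons: "fillings (a # xs) l v = (\<Union>i<l. Cons i ` fillings xs l (v(i := v i - int a)))"
proof (intro equalityI subsetI)
  fix g assume g: "g \<in> fillings (a # xs) l v"
  then obtain i g' where "g = i # g'"
    by (cases g) (auto simp: fillings_def)
  moreover from this g have "i < l" "g' \<in> fillings xs l (v(i := v i - int a))"
    by (auto simp: fillings_def split: if_splits)
  ultimately show "g \<in> (\<Union>i<l. Cons i ` fillings xs l (v(i := v i - int a)))"
    by blast
next
  fix g assume "g \<in> (\<Union>i<l. Cons i ` fillings xs l (v(i := v i - int a)))"
  then show "g \<in> fillings (a # xs) l v"
    by (auto simp: fillings_def split: if_splits)
qed

lemma lookup_mult_0:
  fixes f g :: Sym
  shows "Poly_Mapping.lookup (f * g) 0 = Poly_Mapping.lookup f 0 * Poly_Mapping.lookup g 0"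
proof -
  have *: "(0 :: nat \<Rightarrow>\<^sub>0 nat) = l + q \<longleftrightarrow> l = 0 \<and> q = 0" for l q :: "nat \<Rightarrow>\<^sub>0 nat"
    by (auto simp: poly_mapping_eq_iff fun_eq_iff lookup_add)
  have "(\<Sum>q. Poly_Mapping.lookup g q when l = 0 \<and> q = 0) = (Poly_Mapping.lookup g 0 when l = 0)" for l :: "nat \<Rightarrow>\<^sub>0 nat"
    by (cases "l = 0") auto
  then show ?thesis
    by (simp add: lookup_mult * mult_when)
qed

lemma lookup_qz_0: "Poly_Mapping.lookup (qz l v) 0 = (if \<forall>j<l. v j = 0 then 1 else 0)"
proof (induction l)
  case (Suc l)
  have "qz (Suc l) v = Qz (v l) * qz l v"
    by (simp add: qz_def mult.commute)
  moreover have "Poly_Mapping.lookup (Qz a) 0 = (if a = 0 then 1 else 0)" for a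
    by (auto simp: lookup_Qz pnorm_def elen_def ezee_def)
  ultimately show ?case
    by (auto simp: lookup_mult_0 Suc less_Suc_eq)
qed (simp add: qz_def)

text \<open>Both sides obey the same recursion: moving p_a to the other side of the scalar product
  lowers one entry of v by a, and in a filling the first part a goes into one of the boxes.\<close>

lemma inner_pbasis_qz:
  "0 \<notin> set xs \<Longrightarrow> inner (pbasis xs) (qz l v) = of_nat (card (fillings xs l v))"
proof (induction xs arbitrary: v)
  case Nil
  have "pbasis [] = Poly_Mapping.single 0 1"
    by (simp add: pbasis_eq_single)
  then have "inner (pbasis []) (qz l v) = Poly_Mapping.lookup (qz l v) 0"
    by (simp only: inner_commute[of _ "qz l v"] inner_single_right) (simp add: pnorm_def elen_def ezee_def)
  moreover have "fillings [] l v = (if \<forall>j<l. v j = 0 then {[]} else {})"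
    by (auto simp: fillings_def)
  ultimately show ?case
    by (simp add: lookup_qz_0)
next
  case (Cons a xs)
  have "card (fillings (a # xs) l v) = (\<Sum>i<l. card (Cons i ` fillings xs l (v(i := v i - int a))))"
    unfolding fillings_Cons by (rule card_UN_disjoint) auto
  also have "\<dots> = (\<Sum>i<l. card (fillings xs l (v(i := v i - int a))))"
    by (intro sum.cong card_image) auto
  finally have "of_nat (card (fillings (a # xs) l v)) =
      (\<Sum>i<l. inner (pbasis xs) (qz l (v(i := v i - int a))))"
    using Cons by simp
  moreover have "pbasis (a # xs) = psum a * pbasis xs"
    by (simp add: pbasis_def)
  ultimately show ?case
    using Cons.prems by (simp add: inner_psum_mult perp_qz inner_sum_right One_nat_def Suc_le_eq)
qed

lemma inner_pbasis_qfun: "0 \<notin> set xs \<Longrightarrow> inner (pbasis xs) (qfun ys) = of_nat (Rcount xs ys)"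
  by (simp add: qfun_eq_qz inner_pbasis_qz Rcount_eq)

text \<open>The functions \<open>q\<^sub>\<mu>\<close> are dual to the monomial functions.\<close>
lemma mcoeff_eq_inner:
  assumes "in_Lambda f"
  shows "mcoeff f mu = inner f (qfun mu)"
proof -
  let ?n = "sum_list mu" and ?L = "Poly_Mapping.lookup"
  have R: "of_nat (Rcount lam mu) = ?L (qfun mu) (expo lam) * pnorm (expo lam)" if "lam \<in> partitions_of ?n" for lam
    using that inner_pbasis_qfun[of lam mu]
    by (simp add: partitions_of_def is_partition_def pbasis_eq_single inner_commute[of _ "qfun mu"] inner_single_right)
  have "mcoeff f mu = (\<Sum>lam\<in>partitions_of ?n. ?L f (expo lam) * ?L (qfun mu) (expo lam) * pnorm (expo lam))"
    unfolding mcoeff_def pcoeff_def by (simp add: R mult.assoc)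
  also have "\<dots> = (\<Sum>e\<in>Eset ?n. ?L f e * ?L (qfun mu) e * pnorm e)"
    by (rule sum.reindex_bij_betw[OF bij_betw_expo])
  also have "\<dots> = inner (qfun mu) f"
    using keys_qfun[of _ mu] by (subst inner_superset[of "Eset ?n"]) (auto simp: mult_ac)
  finally show ?thesis
    by (simp add: inner_commute)
qed

lemma fibre_sum_pos_imp_mem: "fibre_sum j g xs > 0 \<Longrightarrow> j \<in> set g"
  by (induction j g xs rule: fibre_sum.induct) (auto split: if_splits)

lemma fibre_sum_distinct:
  "\<lbrakk>length g = length xs; distinct g; i < length xs\<rbrakk> \<Longrightarrow> fibre_sum (g ! i) g xs = xs ! i"
proof (induction g xs arbitrary: i rule: list_induct2)
  case (Cons x g a xs)
  have "fibre_sum x g xs = 0"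
    using fibre_sum_pos_imp_mem[of x g xs] Cons.prems by auto
  with Cons show ?case
    by (cases i) (auto dest: nth_mem)
qed simp

text \<open>Each box has a positive sum and hence receives a part; if there are as many parts as
  boxes, each box receives exactly one.\<close>

lemma fillings_nonempty:
  assumes "g \<in> fillings xs (length ys) (\<lambda>i. int (ys ! i))" "0 \<notin> set ys"
  shows "length ys \<le> length xs" and "length ys = length xs \<Longrightarrow> mset xs = mset ys"
proof -
  have g: "length g = length xs" "set g \<subseteq> {..<length ys}" "\<And>j. j < length ys \<Longrightarrow> fibre_sum j g xs = ys ! j"
    using assms(1) by (auto simp: fillings_def)
  have "j \<in> set g" if "j < length ys" for j
    using that assms(2) g(3) fibre_sum_pos_imp_mem[of j g xs] nth_mem[OF that] by (metis gr0I)
  with g(2) have set_g: "set g = {..<length ys}"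
    by auto
  have "length ys = card (set g)"
    by (simp add: set_g)
  then show "length ys \<le> length xs"
    using card_length[of g] g(1) by simp
  assume eq: "length ys = length xs"
  then have "distinct g"
    using \<open>length ys = card (set g)\<close> g(1) by (simp add: card_distinct)
  then have "xs = map (\<lambda>j. ys ! j) g"
    using g eq fibre_sum_distinct[of g xs] by (intro nth_equalityI) (auto, metis nth_mem lessThan_iff subsetD)
  then have "mset xs = image_mset (\<lambda>j. ys ! j) (mset g)"
    by simp
  also have "mset g = mset [0..<length ys]"
    using \<open>distinct g\<close> set_g set_eq_iff_mset_eq_distinct[of g "[0..<length ys]"]
    by (simp add: atLeast0LessThan)
  also have "image_mset (\<lambda>j. ys ! j) \<dots> = mset ys"
    by (simp only: mset_map[symmetric] map_nth)
  finally show "mset xs = mset ys" .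
qed

lemma Rcount_self: "Rcount xs xs \<noteq> 0"
proof -
  have "[0..<length xs] \<in> fillings xs (length xs) (\<lambda>i. int (xs ! i))"
    using fibre_sum_distinct[of "[0..<length xs]" xs] by (auto simp: fillings_def)
  then show ?thesis
    by (auto simp: Rcount_eq)
qed

lemma qfun_independent:
  assumes zero: "(\<Sum>mu\<in>partitions_of n. const (c mu) * qfun mu) = 0" and mu: "mu \<in> partitions_of n"
  shows "c mu = 0"
proof (rule ccontr)
  assume "c mu \<noteq> 0"
  \<comment> \<open>Among the terms that occur, take one with the fewest parts: \<open>p\<^sub>\<kappa>\<close> pairs with \<open>q\<^sub>\<nu>\<close>
    nontrivially only if \<open>\<kappa>\<close> refines \<open>\<nu>\<close>.\<close>
  with mu obtain kap where kap: "kap \<in> partitions_of n" "c kap \<noteq> 0"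
    and min: "\<And>nu. nu \<in> partitions_of n \<Longrightarrow> c nu \<noteq> 0 \<Longrightarrow> length kap \<le> length nu"
    using ex_has_least_nat[of "\<lambda>k. k \<in> partitions_of n \<and> c k \<noteq> 0" mu length] by auto
  have pos: "0 \<notin> set nu" if "nu \<in> partitions_of n" for nu
    using that by (auto simp: partitions_of_def is_partition_def)
  have "inner (pbasis kap) (\<Sum>mu\<in>partitions_of n. const (c mu) * qfun mu) =
      (\<Sum>nu\<in>partitions_of n. c nu * of_nat (Rcount kap nu))"
    using pos kap by (simp add: inner_sum_right inner_scale_right inner_pbasis_qfun)
  also have "\<dots> = (\<Sum>nu\<in>{kap}. c nu * of_nat (Rcount kap nu))"
  proof (rule sum.mono_neutral_right)
    show "\<forall>nu\<in>partitions_of n - {kap}. c nu * of_nat (Rcount kap nu) = 0"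
    proof
      fix nu assume nu: "nu \<in> partitions_of n - {kap}"
      show "c nu * of_nat (Rcount kap nu) = 0"
      proof (rule ccontr)
        assume nz: "c nu * of_nat (Rcount kap nu) \<noteq> 0"
        then have "Rcount kap nu \<noteq> 0"
          by auto
        then obtain g where g: "g \<in> fillings kap (length nu) (\<lambda>i. int (nu ! i))"
          by (metis Rcount_eq card.empty ex_in_conv)
        have "length nu = length kap"
          using fillings_nonempty(1)[OF g] min[of nu] pos nu nz by force
        then have "mset kap = mset nu"
          using fillings_nonempty(2)[OF g] pos nu by auto
        then show False
          using nu kap by (auto simp: partitions_of_def partition_eq_iff_mset)
      qed
    qed
  qed (use kap in auto)
  finally have "c kap * of_nat (Rcount kap kap) = 0"
    using zero by simp
  with kap Rcount_self[of kap] show False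
    by simp
qed

lemma qfun_inj_on: "inj_on qfun (partitions_of n)"
proof (rule inj_onI, rule ccontr)
  fix lam mu assume *: "lam \<in> partitions_of n" "mu \<in> partitions_of n" "qfun lam = qfun mu" "lam \<noteq> mu"
  define c where "c nu = (if nu = lam then 1 else if nu = mu then -1 else 0 :: F)" for nu
  have "(\<Sum>nu\<in>partitions_of n. const (c nu) * qfun nu) = (\<Sum>nu\<in>{lam, mu}. const (c nu) * qfun nu)"
    using * by (intro sum.mono_neutral_right) (auto simp: c_def)
  also have "\<dots> = 0"
    using * by (simp add: c_def const_uminus)
  finally have "c lam = 0"
    using * qfun_independent by blast
  then show False
    by (simp add: c_def)
qed

section \<open>Homogeneous components\<close>

definition Lambda_deg :: "nat \<Rightarrow> Sym set" where
  "Lambda_deg n = {f. Poly_Mapping.keys f \<subseteq> Eset n}"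

lemma qfun_in_Lambda_deg: "qfun xs \<in> Lambda_deg (sum_list xs)"
  using keys_qfun by (auto simp: Lambda_deg_def)

lemma subspace_Lambda_deg: "sym.subspace (Lambda_deg n)"
proof (rule sym.subspaceI)
  fix f g assume "f \<in> Lambda_deg n" "g \<in> Lambda_deg n"
  then show "f + g \<in> Lambda_deg n"
    using keys_add[of f g] by (auto simp: Lambda_deg_def)
next
  fix c f assume "f \<in> Lambda_deg n"
  moreover have "Poly_Mapping.keys (const c * f) \<subseteq> Poly_Mapping.keys f"
    by (auto simp: in_keys_iff)
  ultimately show "const c * f \<in> Lambda_deg n"
    by (auto simp: Lambda_deg_def)
qed (simp add: Lambda_deg_def)

lemma Lambda_deg_imp_in_Lambda: "f \<in> Lambda_deg n \<Longrightarrow> in_Lambda f"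
  by (auto simp: Lambda_deg_def Eset_def in_Lambda_def)

lemma inner_Lambda_deg: "\<lbrakk>f \<in> Lambda_deg m; g \<in> Lambda_deg n; m \<noteq> n\<rbrakk> \<Longrightarrow> inner f g = 0"
proof -
  assume *: "f \<in> Lambda_deg m" "g \<in> Lambda_deg n" "m \<noteq> n"
  then have "Poly_Mapping.lookup g e = 0" if "e \<in> Poly_Mapping.keys f" for e
    using that unfolding Lambda_deg_def Eset_def by (metis (mono_tags, lifting) in_keys_iff mem_Collect_eq subsetD)
  then show ?thesis
    by (simp add: inner_def)
qed

abbreviation qspan :: "nat \<Rightarrow> Sym set" where
  "qspan n \<equiv> sym.span (qfun ` partitions_of n)"

lemma qfun_in_qspan: "sum_list xs = n \<Longrightarrow> qfun xs \<in> qspan n"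
  by (metis imageI psort_in_partitions_of qfun_psort sym.span_base)

text \<open>In Newton's relation for Q_n the term s = n is p_n itself, so p_n is expressed by Q_n
  and by products p_s Q_(n-s) with s < n. The extra factor \<open>qfun xs\<close> lets the induction
  absorb Q_(n-s) into the list.\<close>

lemma psum_mult_qfun_in_qspan:
  "n \<ge> 1 \<Longrightarrow> psum n * qfun xs \<in> qspan (n + sum_list xs)"
proof (induction n arbitrary: xs rule: less_induct)
  case (less n)
  have Q: "Qz (int n - int s) = Qn (n - s)" if "s \<le> n" for s
    using that by (auto simp: Qz_def nat_diff_distrib' simp flip: of_nat_diff)
  have "const (alpha * of_nat n) * Qn n = (\<Sum>s\<in>{1..n}. psum s * Qn (n - s))"
    using Newton_Qz[of "int n" n] Q Q[of 0] by simp
  also have "{1..n} = insert n {1..<n}"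
    using less.prems by auto
  also have "(\<Sum>s\<in>\<dots>. psum s * Qn (n - s)) = psum n + (\<Sum>s\<in>{1..<n}. psum s * Qn (n - s))"
    by simp
  finally have "psum n = const (alpha * of_nat n) * Qn n - (\<Sum>s\<in>{1..<n}. psum s * Qn (n - s))"
    by simp
  then have "psum n * qfun xs = const (alpha * of_nat n) * qfun (n # xs)
      - (\<Sum>s\<in>{1..<n}. psum s * qfun ((n - s) # xs))"
    by (simp only: qfun_Cons left_diff_distrib sum_distrib_right mult.assoc)
  moreover have "psum s * qfun ((n - s) # xs) \<in> qspan (n + sum_list xs)" if "s \<in> {1..<n}" for s
    using that less.IH[of s "(n - s) # xs"] by simp
  moreover have "qfun (n # xs) \<in> qspan (n + sum_list xs)"
    by (rule qfun_in_qspan) simp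
  ultimately show ?case
    by (auto intro!: sym.span_diff sym.span_sum sym.span_scale simp del: qfun_Cons)
qed

lemma psum_mult_qspan: "\<lbrakk>n \<ge> 1; f \<in> qspan m\<rbrakk> \<Longrightarrow> psum n * f \<in> qspan (n + m)"
proof -
  assume "n \<ge> 1"
  assume "f \<in> qspan m"
  then show ?thesis
  proof (induction rule: sym.span_induct_alt)
    case (step c x y)
    then obtain xs where "x = qfun xs" "sum_list xs = m"
      by (auto simp: partitions_of_def)
    with psum_mult_qfun_in_qspan[OF \<open>n \<ge> 1\<close>, of xs] step show ?case
      by (auto simp: distrib_left mult.left_commute[of "psum n"] intro!: sym.span_add sym.span_scale)
  qed (simp add: sym.span_zero)
qed

lemma pbasis_in_qspan: "0 \<notin> set xs \<Longrightarrow> pbasis xs \<in> qspan (sum_list xs)"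
proof (induction xs)
  case Nil
  have "qfun [] \<in> qspan 0"
    by (rule qfun_in_qspan) simp
  then show ?case
    by (simp add: pbasis_def)
next
  case (Cons a xs)
  then show ?case
    using psum_mult_qspan[of a "pbasis xs" "sum_list xs"] by (simp add: pbasis_def One_nat_def Suc_le_eq)
qed

lemma qspan_eq_Lambda_deg: "qspan n = Lambda_deg n"
proof (intro equalityI subsetI)
  fix f assume "f \<in> qspan n"
  then show "f \<in> Lambda_deg n"
    by (rule sym.span_induct)
       (auto simp: subspace_Lambda_deg partitions_of_def intro: qfun_in_Lambda_deg)
next
  fix f assume f: "f \<in> Lambda_deg n"
  have "Poly_Mapping.single e (Poly_Mapping.lookup f e) \<in> qspan n" if "e \<in> Poly_Mapping.keys f" for e
  proof -
    have "e \<in> expo ` partitions_of n"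
      using that f bij_betw_imp_surj_on[OF bij_betw_expo[of n]] by (auto simp: Lambda_deg_def)
    then obtain lam where lam: "lam \<in> partitions_of n" "e = expo lam"
      by blast
    then have "Poly_Mapping.single e (Poly_Mapping.lookup f e) = const (Poly_Mapping.lookup f e) * pbasis lam"
      by (simp add: pbasis_eq_single const_def mult_single)
    moreover have "pbasis lam \<in> qspan n"
      using lam pbasis_in_qspan[of lam] by (auto simp: partitions_of_def is_partition_def)
    ultimately show ?thesis
      by (simp only: sym.span_scale)
  qed
  then show "f \<in> qspan n"
    by (subst Sym_as_sum[of f]) (rule sym.span_sum)
qed

section \<open>A Lax matrix\<close>

text \<open>A truncated Nazarov--Sklyanin Lax matrix, acting on vectors with components in
  \<open>\<Lambda>\<^sub>F\<close> indexed by \<open>1, \<dots>, N\<close>.\<close>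
definition lax :: "nat \<Rightarrow> nat \<Rightarrow> Sym \<Rightarrow> Sym" where
  "lax m s x = (if s = m then const ((alpha - 1) * of_nat m) * x
     else if m < s then psum (s - m) * x else perp (m - s) x)"

definition Lax :: "nat \<Rightarrow> (nat \<Rightarrow> Sym) \<Rightarrow> nat \<Rightarrow> Sym" where
  "Lax N f m = (if m \<in> {1..N} then \<Sum>s\<in>{1..N}. lax m s (f s) else 0)"

definition row :: "nat \<Rightarrow> nat \<Rightarrow> (nat \<Rightarrow> Sym) \<Rightarrow> Sym" where
  "row N k f = (\<Sum>m\<in>{1..N}. psum m * (Lax N ^^ k) f m)"

definition column :: "nat \<Rightarrow> Sym \<Rightarrow> nat \<Rightarrow> Sym" where
  "column N g m = (if m \<in> {1..N} then perp m g else 0)"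

text \<open>For N at least the weight of g this is \<open>H_k\<close> of the overview.
  Self-adjointness holds for every N; the bound by the weight enters through Newton's relation, when
  the operator is evaluated on products of \<open>Qn\<close>.\<close>

definition ham :: "nat \<Rightarrow> nat \<Rightarrow> Sym \<Rightarrow> Sym" where
  "ham N k g = row N k (column N g)"

lemma lax_lincomb: "lax m s (\<Sum>x\<in>A. const (c x) * f x) = (\<Sum>x\<in>A. const (c x) * lax m s (f x))"
  unfolding lax_def by (auto simp: sum_distrib_left perp_sum perp_scale mult.left_commute)

lemma Lax_lincomb:
  "Lax N (\<lambda>m. \<Sum>x\<in>A. const (c x) * f x m) = (\<lambda>m. \<Sum>x\<in>A. const (c x) * Lax N (f x) m)"
proof
  fix m
  have "(\<Sum>s\<in>{1..N}. \<Sum>x\<in>A. const (c x) * lax m s (f x s)) = (\<Sum>x\<in>A. \<Sum>s\<in>{1..N}. const (c x) * lax m s (f x s))"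
    by (rule sum.swap)
  then show "Lax N (\<lambda>m. \<Sum>x\<in>A. const (c x) * f x m) m = (\<Sum>x\<in>A. const (c x) * Lax N (f x) m)"
    by (auto simp: Lax_def lax_lincomb sum_distrib_left)
qed

lemma Lax_funpow_lincomb:
  "(Lax N ^^ k) (\<lambda>m. \<Sum>x\<in>A. const (c x) * f x m) = (\<lambda>m. \<Sum>x\<in>A. const (c x) * (Lax N ^^ k) (f x) m)"
  by (induction k) (simp_all add: Lax_lincomb)

lemma row_lincomb:
  "row N k (\<lambda>m. \<Sum>x\<in>A. const (c x) * f x m) = (\<Sum>x\<in>A. const (c x) * row N k (f x))"
proof -
  have "(\<Sum>m\<in>{1..N}. \<Sum>x\<in>A. psum m * (const (c x) * (Lax N ^^ k) (f x) m)) =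
      (\<Sum>x\<in>A. \<Sum>m\<in>{1..N}. psum m * (const (c x) * (Lax N ^^ k) (f x) m))"
    by (rule sum.swap)
  then show ?thesis
    by (simp add: row_def Lax_funpow_lincomb sum_distrib_left mult.left_commute)
qed

lemma row_sum: "row N k (\<lambda>m. \<Sum>x\<in>A. f x m) = (\<Sum>x\<in>A. row N k (f x))"
  using row_lincomb[where c = "\<lambda>_. 1"] by simp

lemma row_add: "row N k (\<lambda>m. f m + g m) = row N k f + row N k g"
  using row_sum[of N k "\<lambda>b m. if b then f m else g m" UNIV] by (simp add: UNIV_bool add.commute)

lemma row_scale: "row N k (\<lambda>m. const c * f m) = const c * row N k f"
  using row_lincomb[where A = "{()}" and c = "\<lambda>_. c" and f = "\<lambda>_. f"] by simp

lemma row_diff: "row N k (\<lambda>m. f m - g m) = row N k f - row N k g"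
  using row_add[of N k "\<lambda>m. f m - g m" g] by simp

lemma ham_lincomb: "ham N k (\<Sum>x\<in>A. const (c x) * g x) = (\<Sum>x\<in>A. const (c x) * ham N k (g x))"
proof -
  have "column N (\<Sum>x\<in>A. const (c x) * g x) = (\<lambda>m. \<Sum>x\<in>A. const (c x) * column N (g x) m)"
    by (auto simp: column_def perp_sum perp_scale fun_eq_iff)
  then show ?thesis
    by (simp add: ham_def row_lincomb)
qed

lemma lax_adjoint: "inner (lax m s x) y = inner x (lax s m y)"
  by (auto simp: lax_def inner_scale_left inner_scale_right inner_psum_mult)
     (subst (1 2) inner_commute, simp add: inner_psum_mult)

lemma Lax_adjoint:
  "(\<Sum>m\<in>{1..N}. inner (Lax N f m) (g m)) = (\<Sum>m\<in>{1..N}. inner (f m) (Lax N g m))"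
proof -
  have "(\<Sum>m\<in>{1..N}. \<Sum>s\<in>{1..N}. inner (f s) (lax s m (g m))) =
      (\<Sum>s\<in>{1..N}. \<Sum>m\<in>{1..N}. inner (f s) (lax s m (g m)))"
    by (rule sum.swap)
  then show ?thesis
    by (simp add: Lax_def inner_sum_left inner_sum_right lax_adjoint[of _ _ "f _"])
qed

lemma Lax_funpow_adjoint:
  "(\<Sum>m\<in>{1..N}. inner ((Lax N ^^ k) f m) (g m)) = (\<Sum>m\<in>{1..N}. inner (f m) ((Lax N ^^ k) g m))"
proof (induction k arbitrary: f)
  case (Suc k)
  have "(\<Sum>m\<in>{1..N}. inner ((Lax N ^^ Suc k) f m) (g m)) =
      (\<Sum>m\<in>{1..N}. inner (Lax N f m) ((Lax N ^^ k) g m))"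
    unfolding funpow_Suc_right o_def by (rule Suc.IH)
  then show ?case
    by (simp add: Lax_adjoint)
qed simp

text \<open>The outer row of p_m is adjoint to the outer column of \<open>perp m\<close>, and
  opposite entries of the matrix between them are adjoint to each other.\<close>

lemma ham_self_adjoint: "inner (ham N k g) h = inner g (ham N k h)"
proof -
  have ham: "inner (ham N k g) h = (\<Sum>m\<in>{1..N}. inner ((Lax N ^^ k) (column N g) m) (column N h m))" for g h
    unfolding ham_def row_def inner_sum_left by (intro sum.cong) (auto simp: inner_psum_mult column_def)
  show ?thesis
    unfolding ham Lax_funpow_adjoint by (subst inner_commute[of g], subst ham) (simp only: inner_commute)
qed

text \<open>The part of the column of q_v in which the derivative hits the i-th factor, see
  \<open>column_qz\<close>.\<close>

definition strip :: "nat \<Rightarrow> nat \<Rightarrow> (nat \<Rightarrow> int) \<Rightarrow> nat \<Rightarrow> nat \<Rightarrow> Sym" where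
  "strip N l v i m = (if m \<in> {1..N} then qz l (v(i := v i - int m)) else 0)"

definition shift :: "nat \<Rightarrow> nat \<Rightarrow> nat \<Rightarrow> (nat \<Rightarrow> int) \<Rightarrow> nat \<Rightarrow> int" where
  "shift a b k v = v(a := v a + int k, b := v b - int k)"

lemma column_qz: "column N (qz l v) = (\<lambda>m. \<Sum>i<l. strip N l v i m)"
  by (auto simp: column_def strip_def perp_qz fun_eq_iff)

lemma row_0_strip:
  assumes "i < l" "v i \<le> int N"
  shows "row N 0 (strip N l v i) = const (alpha * of_int (v i)) * qz l v"
proof -
  have "row N 0 (strip N l v i) = (\<Sum>m\<in>{1..N}. psum m * Qz (v i - int m)) * (\<Prod>j\<in>{..<l} - {i}. Qz (v j))"
    unfolding row_def sum_distrib_right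
    by (intro sum.cong) (auto simp: strip_def qz_upd[OF assms(1)] mult.assoc)
  also have "\<dots> = const (alpha * of_int (v i)) * qz l (v(i := v i))"
    unfolding Newton_Qz[OF assms(2)] qz_upd[OF assms(1)] by (simp add: mult.assoc)
  finally show ?thesis
    by simp
qed

text \<open>In all products the entries at a and b have the same sum v a + v b - m, so each product
  is the value of one function G at its entry at a. The three sums are sums of G over intervals: the
  first family on the right starts at v a - m + 1, since it begins with k = 1; the second starts at
  v a, since it begins with k = 0; their difference is the interval on the left.\<close>

lemma strip_shift_telescope:
  assumes ab: "a < l" "b < l" "a \<noteq> b" and vb: "v b \<ge> 0" and m: "m \<in> {1..N}"
  shows "(\<Sum>s\<in>{1..<m}. qz l (v(a := v a - int s, b := v b - int (m - s)))) =
    (\<Sum>k\<in>{1..nat (v b)}. strip N l (shift a b k v) a m) - (\<Sum>k\<in>{0..nat (v b)}. strip N l (shift a b k v) b m)"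
proof -
  define G where "G x = Qz x * Qz (v a + v b - int m - x) * (\<Prod>j\<in>{..<l} - {a, b}. Qz (v j))" for x
  have "(\<Sum>s\<in>{1..<m}. qz l (v(a := v a - int s, b := v b - int (m - s)))) = (\<Sum>s\<in>{1..<m}. G (v a - int s))"
    by (intro sum.cong refl) (auto simp: qz_upd2[OF ab] G_def of_nat_diff algebra_simps)
  also have "\<dots> = (\<Sum>x\<in>{v a - int m + 1..v a - 1}. G x)"
    by (rule sum.reindex_bij_witness[of _ "\<lambda>x. nat (v a - x)" "\<lambda>s. v a - int s"]) auto
  finally have L: "(\<Sum>s\<in>{1..<m}. qz l (v(a := v a - int s, b := v b - int (m - s)))) =
    (\<Sum>x\<in>{v a - int m + 1..v a - 1}. G x)" .
  have "(\<Sum>k\<in>{1..nat (v b)}. strip N l (shift a b k v) a m) = (\<Sum>k\<in>{1..nat (v b)}. G (v a + int k - int m))"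
  proof (intro sum.cong refl)
    fix k
    have "(shift a b k v)(a := shift a b k v a - int m) = v(a := v a + int k - int m, b := v b - int k)"
      using ab by (auto simp: shift_def)
    then show "strip N l (shift a b k v) a m = G (v a + int k - int m)"
      using m by (simp add: strip_def qz_upd2[OF ab] G_def)
  qed
  also have "\<dots> = (\<Sum>x\<in>{v a - int m + 1..v a + v b - int m}. G x)"
    by (rule sum.reindex_bij_witness[of _ "\<lambda>x. nat (x - v a + int m)" "\<lambda>k. v a + int k - int m"]) auto
  \<comment> \<open>Beyond v a + v b - m the entry at b is negative and G vanishes, so both
    intervals may be given the same end.\<close>
  also have "\<dots> = (\<Sum>x\<in>{v a - int m + 1..v a + v b}. G x)"
    by (rule sum.mono_neutral_left) (auto simp: G_def Qz_neg)
  also have "{v a - int m + 1..v a + v b} = {v a - int m + 1..v a - 1} \<union> {v a..v a + v b}"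
    using vb m by auto
  also have "(\<Sum>x\<in>\<dots>. G x) = (\<Sum>x\<in>{v a - int m + 1..v a - 1}. G x) + (\<Sum>x\<in>{v a..v a + v b}. G x)"
    by (rule sum.union_disjoint) auto
  also have "(\<Sum>x\<in>{v a..v a + v b}. G x) = (\<Sum>k\<in>{0..nat (v b)}. G (v a + int k))"
    by (rule sum.reindex_bij_witness[of _ "\<lambda>k. v a + int k" "\<lambda>x. nat (x - v a)"]) (use vb in auto)
  also have "\<dots> = (\<Sum>k\<in>{0..nat (v b)}. strip N l (shift a b k v) b m)"
  proof (intro sum.cong refl)
    fix k
    have "(shift a b k v)(b := shift a b k v b - int m) = v(a := v a + int k, b := v b - int k - int m)"
      using ab by (auto simp: shift_def)
    then show "G (v a + int k) = strip N l (shift a b k v) b m"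
      using m by (simp add: strip_def qz_upd2[OF ab] G_def algebra_simps)
  qed
  finally show ?thesis
    unfolding L by simp
qed

text \<open>Above the diagonal, Newton's relation gives \<alpha> (v i - m); the diagonal gives
  (\<alpha> - 1) m; below it, the derivative hits the i-th factor again in m - 1 cases, each time
  producing the same product. The sum \<alpha> v i - 1 no longer depends on m, so the strip is
  reproduced up to a scalar. The remaining terms come from derivatives that hit another factor
  j.\<close>

lemma Lax_strip:
  assumes i: "i < l" and vi: "v i \<le> int N"
  shows "Lax N (strip N l v i) m = const (alpha * of_int (v i) - 1) * strip N l v i m +
    (\<Sum>j\<in>{..<l} - {i}. if m \<in> {1..N}
       then \<Sum>s\<in>{1..<m}. qz l (v(i := v i - int s, j := v j - int (m - s))) else 0)"
proof (cases "m \<in> {1..N}")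
  case m: True
  let ?q = "\<lambda>s. qz l (v(i := v i - int s))" and ?R = "\<Prod>j\<in>{..<l} - {i}. Qz (v j)"
  have "{1..N} = {1..<m} \<union> ({m} \<union> {m+1..N})"
    using m by auto
  then have "Lax N (strip N l v i) m = (\<Sum>s\<in>{1..<m} \<union> ({m} \<union> {m+1..N}). lax m s (?q s))"
    using m unfolding Lax_def strip_def by (auto intro!: sum.cong)
  also have "\<dots> = (\<Sum>s\<in>{1..<m}. perp (m - s) (?q s)) + (const ((alpha - 1) * of_nat m) * ?q m
      + (\<Sum>s\<in>{m+1..N}. psum (s - m) * ?q s))"
    by (subst sum.union_disjoint; (subst sum.union_disjoint)?)
       (auto simp: lax_def intro!: arg_cong2[where f = "(+)"] sum.cong)
  finally have split: "Lax N (strip N l v i) m = (\<Sum>s\<in>{1..<m}. perp (m - s) (?q s)) +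
      (const ((alpha - 1) * of_nat m) * ?q m + (\<Sum>s\<in>{m+1..N}. psum (s - m) * ?q s))" .
  have upper: "(\<Sum>s\<in>{m+1..N}. psum (s - m) * ?q s) = const (alpha * of_int (v i - int m)) * ?q m"
  proof -
    have "(\<Sum>s\<in>{m+1..N}. psum (s - m) * ?q s) = (\<Sum>r\<in>{1..N-m}. psum r * Qz (v i - int m - int r)) * ?R"
      unfolding sum_distrib_right
      by (rule sum.reindex_bij_witness[of _ "\<lambda>r. r + m" "\<lambda>s. s - m"])
         (use m in \<open>auto simp: qz_upd[OF i] mult.assoc of_nat_diff algebra_simps\<close>)
    also have "\<dots> = const (alpha * of_int (v i - int m)) * ?q m"
      by (subst Newton_Qz) (use vi m in \<open>auto simp: qz_upd[OF i] mult.assoc of_nat_diff\<close>)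
    finally show ?thesis .
  qed
  have lower: "(\<Sum>s\<in>{1..<m}. perp (m - s) (?q s)) = const (of_nat m - 1) * ?q m +
    (\<Sum>j\<in>{..<l} - {i}. \<Sum>s\<in>{1..<m}. qz l (v(i := v i - int s, j := v j - int (m - s))))"
  proof -
    have "perp (m - s) (?q s) = ?q m + (\<Sum>j\<in>{..<l} - {i}. qz l (v(i := v i - int s, j := v j - int (m - s))))"
      if "s \<in> {1..<m}" for s
    proof -
      have "perp (m - s) (?q s) =
          (\<Sum>j<l. qz l ((v(i := v i - int s))(j := (v(i := v i - int s)) j - int (m - s))))"
        using that by (intro perp_qz) auto
      also have "\<dots> = ?q m + (\<Sum>j\<in>{..<l} - {i}. qz l (v(i := v i - int s, j := v j - int (m - s))))"
        using i that by (subst sum.remove[of _ i])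
          (auto simp: of_nat_diff intro!: arg_cong2[where f = "(+)"] sum.cong)
      finally show ?thesis .
    qed
    then have "(\<Sum>s\<in>{1..<m}. perp (m - s) (?q s)) = of_nat (m - 1) * ?q m +
        (\<Sum>s\<in>{1..<m}. \<Sum>j\<in>{..<l} - {i}. qz l (v(i := v i - int s, j := v j - int (m - s))))"
      by (simp add: sum.distrib)
    moreover have "of_nat (m - 1) = const (of_nat m - 1)"
      using m by (simp add: const_diff const_of_nat of_nat_diff)
    ultimately show ?thesis
      by (simp add: sum.swap[of _ "{..<l} - {i}"])
  qed
  have "of_nat m - 1 + (alpha - 1) * of_nat m + alpha * of_int (v i - int m) = alpha * of_int (v i) - 1"
    by (simp add: algebra_simps)
  then have coeff: "const (of_nat m - 1) * x + (const ((alpha - 1) * of_nat m) * x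
      + const (alpha * of_int (v i - int m)) * x) = const (alpha * of_int (v i) - 1) * x" for x
    by (simp only: distrib_right[symmetric] const_add[symmetric] add.assoc)
  show ?thesis
    using m unfolding split upper lower by (simp only: coeff[symmetric] strip_def if_True add_ac)
qed (auto simp: Lax_def strip_def)

text \<open>For each pair of indices, either of them may be taken as the one that grows: the
  sum evaluated by \<open>strip_shift_telescope\<close> is symmetric.\<close>
lemma row_Suc_strip:
  assumes i: "i < l" and vi: "v i \<le> int N" and v: "\<And>j. j < l \<Longrightarrow> v j \<ge> 0"
    and hi: "\<And>j. j < l \<Longrightarrow> j \<noteq> i \<Longrightarrow> hi j = i \<and> lo j = j \<or> hi j = j \<and> lo j = i"
  shows "row N (Suc k) (strip N l v i) = const (alpha * of_int (v i) - 1) * row N k (strip N l v i) +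
    (\<Sum>j\<in>{..<l} - {i}. (\<Sum>r\<in>{1..nat (v (lo j))}. row N k (strip N l (shift (hi j) (lo j) r v) (hi j)))
       - (\<Sum>r\<in>{0..nat (v (lo j))}. row N k (strip N l (shift (hi j) (lo j) r v) (lo j))))"
proof -
  have cross: "(if m \<in> {1..N} then \<Sum>s\<in>{1..<m}. qz l (v(i := v i - int s, j := v j - int (m - s))) else 0) =
     (\<Sum>r\<in>{1..nat (v (lo j))}. strip N l (shift (hi j) (lo j) r v) (hi j) m)
       - (\<Sum>r\<in>{0..nat (v (lo j))}. strip N l (shift (hi j) (lo j) r v) (lo j) m)"
    if j: "j \<in> {..<l} - {i}" for j m
  proof (cases "m \<in> {1..N}")
    case m: True
    from j hi[of j] consider "hi j = i" "lo j = j" | "hi j = j" "lo j = i"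
      by auto
    then show ?thesis
    proof cases
      case 1
      with m j i v[of j] show ?thesis
        using strip_shift_telescope[of i l j v m N] by simp
    next
      case 2
      have "(\<Sum>s\<in>{1..<m}. qz l (v(i := v i - int s, j := v j - int (m - s)))) =
        (\<Sum>s\<in>{1..<m}. qz l (v(j := v j - int s, i := v i - int (m - s))))"
        by (rule sum.reindex_bij_witness[of _ "\<lambda>s. m - s" "\<lambda>s. m - s"])
           (use j in \<open>auto simp: fun_upd_twist\<close>)
      with 2 m j i v[of i] show ?thesis
        using strip_shift_telescope[of j l i v m N] by simp
    qed
  qed (auto simp: strip_def)
  have "row N (Suc k) (strip N l v i) = row N k (Lax N (strip N l v i))"
    by (simp add: row_def funpow_Suc_right del: funpow.simps)
  also have "Lax N (strip N l v i) = (\<lambda>m. const (alpha * of_int (v i) - 1) * strip N l v i m +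
     (\<Sum>j\<in>{..<l} - {i}. (\<Sum>r\<in>{1..nat (v (lo j))}. strip N l (shift (hi j) (lo j) r v) (hi j) m)
       - (\<Sum>r\<in>{0..nat (v (lo j))}. strip N l (shift (hi j) (lo j) r v) (lo j) m)))"
    using cross by (auto simp: fun_eq_iff Lax_strip[where v = v, OF i vi] intro!: sum.cong)
  finally show ?thesis
    by (simp only: row_add row_scale row_sum row_diff)
qed

section \<open>Dominance and triangularity\<close>

declare One_nat_def [simp]

definition above :: "nat list \<Rightarrow> nat list set" where
  "above lam = {mu. is_partition mu \<and> dominates mu lam \<and> mu \<noteq> lam}"

text \<open>In the usual notation n(\<lambda>) + |\<lambda>|. It strictly decreases upwards in the
  dominance order, which makes it the measure for inductions along that order, and it is the
  \<alpha>-free part of - e'.\<close>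

definition nstat :: "nat list \<Rightarrow> nat" where
  "nstat lam = (\<Sum>i<length lam. (i + 1) * lam ! i)"

lemma above_subset_partitions_of: "above lam \<subseteq> partitions_of (sum_list lam)"
  by (auto simp: above_def partitions_of_def dominates_def)

lemma nstat_Cons: "nstat (a # xs) = a + sum_list xs + nstat xs"
proof -
  have "nstat (a # xs) = a + (\<Sum>i<length xs. (i + 2) * xs ! i)"
    unfolding nstat_def by (simp add: sum.lessThan_Suc_shift algebra_simps del: sum.lessThan_Suc)
  also have "(\<Sum>i<length xs. (i + 2) * xs ! i) = (\<Sum>i<length xs. xs ! i) + (\<Sum>i<length xs. (i + 1) * xs ! i)"
    by (simp add: algebra_simps flip: sum.distrib)
  also have "(\<Sum>i<length xs. xs ! i) = sum_list xs"
    by (simp add: sum_list_sum_nth atLeast0LessThan)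
  finally show ?thesis
    by (simp add: nstat_def)
qed

text \<open>The i-th part, counted from 1, lies in exactly i tails. Dominance compares tails one by
  one, and the common bound L allows partitions of different lengths.\<close>

lemma nstat_eq_sum_tails:
  "length xs \<le> L \<Longrightarrow> nstat xs = (\<Sum>k<L. sum_list xs - sum_list (take k xs))"
proof (induction xs arbitrary: L)
  case (Cons a xs)
  then obtain L' where "L = Suc L'"
    by (cases L) auto
  with Cons show ?case
    by (simp add: nstat_Cons sum.lessThan_Suc_shift del: sum.lessThan_Suc)
qed (simp add: nstat_def)

lemma take_sums_eq_imp_eq:
  fixes xs ys :: "nat list"
  shows "\<lbrakk>0 \<notin> set xs; 0 \<notin> set ys; \<And>k. sum_list (take k xs) = sum_list (take k ys)\<rbrakk> \<Longrightarrow> xs = ys"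
proof (induction xs arbitrary: ys)
  case Nil
  from Nil(3)[of "Suc 0"] Nil(2) show ?case
    by (cases ys) auto
next
  case (Cons x xs)
  from Cons.prems(3)[of "Suc 0"] Cons.prems(1) obtain ys' where ys: "ys = x # ys'"
    by (cases ys) auto
  have "sum_list (take k xs) = sum_list (take k ys')" for k
    using Cons.prems(3)[of "Suc k"] by (simp add: ys)
  with Cons.IH[of ys'] Cons.prems show ?case
    by (simp add: ys)
qed

lemma nstat_less:
  assumes "is_partition lam" "mu \<in> above lam"
  shows "nstat mu < nstat lam"
proof -
  define L where "L = Suc (length lam + length mu)"
  have mu: "is_partition mu" "sum_list mu = sum_list lam" "mu \<noteq> lam"
    "\<And>k. sum_list (take k lam) \<le> sum_list (take k mu)"
    using assms by (auto simp: above_def dominates_def)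
  obtain k where k: "sum_list (take k lam) \<noteq> sum_list (take k mu)"
    using take_sums_eq_imp_eq[of lam mu] mu assms(1) by (auto simp: is_partition_def)
  have "k < L"
  proof (rule ccontr)
    assume "\<not> k < L"
    then have "take k lam = lam" "take k mu = mu"
      by (auto simp: L_def)
    with k mu(2) show False
      by simp
  qed
  have le: "sum_list (take k mu) \<le> sum_list mu" for k
    by (metis append_take_drop_id le_add1 sum_list_append)
  have "(\<Sum>k<L. sum_list mu - sum_list (take k mu)) < (\<Sum>k<L. sum_list lam - sum_list (take k lam))"
  proof (rule sum_strict_mono_ex1)
    show "\<forall>k\<in>{..<L}. sum_list mu - sum_list (take k mu) \<le> sum_list lam - sum_list (take k lam)"
      using mu by (auto intro: diff_le_mono2)
    have "sum_list (take k lam) < sum_list (take k mu)"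
      using k mu(4)[of k] by simp
    with le[of k] mu(2) have "sum_list mu - sum_list (take k mu) < sum_list lam - sum_list (take k lam)"
      by linarith
    with \<open>k < L\<close> show "\<exists>k\<in>{..<L}. sum_list mu - sum_list (take k mu) < sum_list lam - sum_list (take k lam)"
      by blast
  qed simp
  then show ?thesis
    using nstat_eq_sum_tails[of lam L] nstat_eq_sum_tails[of mu L] by (simp add: L_def)
qed

lemma above_trans:
  assumes "is_partition lam" "mu \<in> above lam" "kap \<in> above mu"
  shows "kap \<in> above lam"
proof -
  \<comment> \<open>Strict decrease rules out that \<open>kap\<close> has come back to
    \<open>lam\<close>.\<close>
  have "nstat kap < nstat lam"
    using assms nstat_less[of lam mu] nstat_less[of mu kap] by (auto simp: above_def)
  with assms show ?thesis
    by (auto simp: above_def dominates_def intro: order_trans)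
qed

lemma above_mono: "\<lbrakk>is_partition lam; mu \<in> above lam\<rbrakk> \<Longrightarrow> above mu \<subseteq> above lam"
  using above_trans by blast

text \<open>Truncated subtraction makes the summand max (x - t) 0. Unlike partial sums, this
  quantity is insensitive to reordering and to zero entries, so it is easy to follow through a
  move.\<close>

definition tsum :: "nat \<Rightarrow> nat list \<Rightarrow> nat" where
  "tsum t xs = (\<Sum>x\<leftarrow>xs. x - t)"

lemma tsum_append: "tsum t (xs @ ys) = tsum t xs + tsum t ys"
  by (simp add: tsum_def)

lemma sum_list_le_tsum: "sum_list xs \<le> tsum t xs + length xs * t"
  by (induction xs) (auto simp: tsum_def)

lemma sum_list_eq_tsum: "(\<And>x. x \<in> set xs \<Longrightarrow> t \<le> x) \<Longrightarrow> sum_list xs = tsum t xs + length xs * t"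
proof (induction xs)
  case (Cons a xs)
  then have "t \<le> a" "sum_list xs = tsum t xs + length xs * t"
    by auto
  then show ?case
    by (simp add: tsum_def)
qed (simp add: tsum_def)

text \<open>Dominance is majorization: it can be tested with the convex functions
  \<open>x \<mapsto> max (x - t) 0\<close>.\<close>
lemma dominatesI_tsum:
  assumes mu: "is_partition mu" and sum: "sum_list mu = sum_list lam"
    and le: "\<And>t. tsum t lam \<le> tsum t mu"
  shows "dominates mu lam"
  unfolding dominates_def
proof (intro conjI allI sum)
  fix k
  show "sum_list (take k lam) \<le> sum_list (take k mu)"
  proof (cases "k < length mu")
    case False
    have "sum_list (take k lam) \<le> sum_list lam"
      by (metis append_take_drop_id le_add1 sum_list_append)
    with False sum show ?thesis
      by simp
  next
    case True
    \<comment> \<open>The first part of \<open>mu\<close> that is not taken: the earlier parts are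
      at least t, so their truncation is exact, and the later ones contribute nothing.\<close>
    define t where "t = mu ! k"
    have sorted: "mu ! j \<le> mu ! i" if "i \<le> j" "j < length mu" for i j
      using mu that by (cases "i = j") (auto simp: is_partition_def sorted_wrt_iff_nth_less)
    have "sum_list (take k lam) \<le> tsum t (take k lam) + k * t"
      using sum_list_le_tsum[of "take k lam" t] by (rule order_trans) (auto simp: min_def)
    also have "tsum t (take k lam) \<le> tsum t lam"
      using tsum_append[of t "take k lam" "drop k lam"] by simp
    also have "tsum t lam \<le> tsum t mu"
      by (rule le)
    also have "tsum t mu = tsum t (take k mu) + tsum t (drop k mu)"
      using tsum_append[of t "take k mu" "drop k mu"] by simp
    also have "tsum t (drop k mu) = 0"
      using sorted by (auto simp: tsum_def t_def in_set_conv_nth)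
    also have "tsum t (take k mu) + 0 + k * t = sum_list (take k mu)"
      using True sorted by (subst sum_list_eq_tsum[of _ t]) (auto simp: t_def in_set_conv_nth)
    finally show ?thesis
      by simp
  qed
qed

lemma tsum_psort [simp]: "tsum t (psort xs) = tsum t xs"
proof -
  have "tsum t (psort xs) = sum_mset (image_mset (\<lambda>x. x - t) (mset (filter (\<lambda>x. x \<noteq> 0) xs)))"
    unfolding tsum_def sum_mset_sum_list[symmetric] mset_map by (simp add: psort_def)
  also have "\<dots> = tsum t xs"
    by (induction xs) (auto simp: tsum_def)
  finally show ?thesis .
qed

definition part :: "nat \<Rightarrow> (nat \<Rightarrow> int) \<Rightarrow> nat list" where
  "part l v = psort (map (\<lambda>i. nat (v i)) [0..<l])"

lemma is_partition_part [simp]: "is_partition (part l v)"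
  by (simp add: part_def)

lemma sum_list_part: "sum_list (part l v) = (\<Sum>i<l. nat (v i))"
  by (simp add: part_def interv_sum_list_conv_sum_set_nat atLeast0LessThan)

lemma tsum_part: "tsum t (part l v) = (\<Sum>i<l. nat (v i) - t)"
  by (simp add: part_def) (simp add: tsum_def o_def interv_sum_list_conv_sum_set_nat atLeast0LessThan)

lemma qz_eq_qfun_part: "(\<And>i. i < l \<Longrightarrow> v i \<ge> 0) \<Longrightarrow> qz l v = qfun (part l v)"
  by (simp add: part_def) (simp add: qfun_eq_qz qz_def)

lemma part_nth: "is_partition lam \<Longrightarrow> part (length lam) (\<lambda>i. int (lam ! i)) = lam"
  by (simp add: part_def map_nth psort_partition)

lemma sum_fun_upd2:
  fixes f :: "int \<Rightarrow> nat" and a b l :: nat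
  assumes "a < l" "b < l" "a \<noteq> b"
  shows "(\<Sum>i<l. f ((v(a := x, b := y)) i)) + (f (v a) + f (v b)) = (\<Sum>i<l. f (v i)) + (f x + f y)"
proof -
  have *: "(\<Sum>i<l. g i) = g a + (g b + (\<Sum>i\<in>{..<l} - {a} - {b}. g i))" for g :: "nat \<Rightarrow> nat"
    using assms by (subst sum.remove[of _ a], simp, simp, subst sum.remove[of _ b]) auto
  have "(\<Sum>i\<in>{..<l} - {a} - {b}. f ((v(a := x, b := y)) i)) = (\<Sum>i\<in>{..<l} - {a} - {b}. f (v i))"
    by (intro sum.cong) auto
  then show ?thesis
    using assms by (simp only: *[of "\<lambda>i. f (v i)"] *[of "\<lambda>i. f ((v(a := x, b := y)) i)"]) simp
qed

lemma sum_list_part_shift: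
  assumes ab: "a < l" "b < l" "a \<noteq> b" and "v a \<ge> 0" "int r \<le> v b"
  shows "sum_list (part l (shift a b r v)) = sum_list (part l v)"
  unfolding sum_list_part shift_def
  using sum_fun_upd2[OF ab, of nat v "v a + int r" "v b - int r"] assms
  by (simp add: nat_add_distrib nat_diff_distrib')

text \<open>Spreading two entries apart increases sums of convex functions. At the threshold v a the
  increase is strict: of the four old and new entries only v a + r exceeds it.\<close>

lemma part_shift_in_above:
  assumes ab: "a < l" "b < l" "a \<noteq> b" and v: "v b \<le> v a" and r: "r \<ge> 1" "int r \<le> v b"
  shows "part l (shift a b r v) \<in> above (part l v)"
proof -
  have eq: "tsum t (part l (shift a b r v)) + ((nat (v a) - t) + (nat (v b) - t)) =
      tsum t (part l v) + ((nat (v a + int r) - t) + (nat (v b - int r) - t))" for t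
    unfolding tsum_part shift_def by (rule sum_fun_upd2[OF ab, of "\<lambda>x. nat x - t"])
  have "tsum t (part l v) \<le> tsum t (part l (shift a b r v))" for t
    using eq[of t] v r by linarith
  moreover have "sum_list (part l (shift a b r v)) = sum_list (part l v)"
    using assms by (intro sum_list_part_shift) auto
  moreover have "tsum (nat (v a)) (part l v) < tsum (nat (v a)) (part l (shift a b r v))"
  proof -
    have "nat (v b) - nat (v a) = 0" "nat (v a + int r) - nat (v a) > 0"
      using v r by auto
    moreover have "x < y" if "y + (0 + m) = x + (p + q)" "m = 0" "p > 0" for x y m p q :: nat
      using that by simp
    ultimately show ?thesis
      using eq[of "nat (v a)"] by (metis diff_self_eq_0)
  qed
  ultimately show ?thesis
    by (auto simp: above_def intro!: dominatesI_tsum)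
qed

text \<open>The coefficient x may be zero, so leading terms add up without case distinctions about
  cancellation. Equal elements still have equal x, by \<open>lead_unique\<close>, and this is how
  eigenvalues are told apart.\<close>

definition lead :: "nat \<Rightarrow> rat \<Rightarrow> F \<Rightarrow> bool" where
  "lead d x c \<longleftrightarrow> (\<exists>p. c = Fract p 1 \<and> Polynomial.degree p \<le> d \<and> Polynomial.coeff p d = x)"

lemma lead_unique: "\<lbrakk>lead d x c; lead d y c\<rbrakk> \<Longrightarrow> x = y"
  by (auto simp: lead_def eq_fract)

lemma lead_zero: "lead d 0 0"
  by (auto simp: lead_def Zero_fract_def intro!: exI[of _ 0])

lemma lead_add: "\<lbrakk>lead d x c; lead d y c'\<rbrakk> \<Longrightarrow> lead d (x + y) (c + c')"
  unfolding lead_def by (metis add_fract coeff_add degree_add_le mult_1_right one_neq_zero)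

lemma lead_uminus: "lead d x c \<Longrightarrow> lead d (- x) (- c)"
  unfolding lead_def by (metis coeff_minus degree_minus minus_fract)

lemma lead_sum: "(\<And>x. x \<in> A \<Longrightarrow> lead d (f x) (c x)) \<Longrightarrow> lead d (\<Sum>x\<in>A. f x) (\<Sum>x\<in>A. c x)"
  by (induction A rule: infinite_finite_induct) (auto intro: lead_zero lead_add)

lemma lead_Suc: "lead d x c \<Longrightarrow> lead (Suc d) 0 c"
  by (auto simp: lead_def coeff_eq_0)

lemma of_int_eq_Fract: "(of_int x :: F) = Fract [:of_int x:] 1"
proof (cases x)
  case (nonneg n)
  then show ?thesis
    by (simp add: of_nat_fract of_nat_poly)
next
  case (neg n)
  have "(of_nat (Suc n) :: F) = Fract [:of_nat (Suc n):] 1"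
    by (simp only: of_nat_fract of_nat_poly)
  with neg show ?thesis
    by (simp only: of_int_minus of_int_of_nat_eq minus_fract minus_pCons minus_zero)
qed

lemma alpha_of_int_eq_Fract: "alpha * of_int x = Fract [:0, of_int x:] 1"
  by (simp add: alpha_def of_int_eq_Fract)

lemma lead_linear_mult:
  assumes "lead d x c"
  shows "lead (Suc d) (of_int v * x) ((alpha * of_int v - 1) * c)"
proof -
  obtain p where p: "c = Fract p 1" "Polynomial.degree p \<le> d" "Polynomial.coeff p d = x"
    using assms by (auto simp: lead_def)
  have "alpha * of_int v - 1 = Fract [:-1, of_int v:] 1"
    by (simp add: alpha_of_int_eq_Fract One_fract_def one_pCons)
  then have "(alpha * of_int v - 1) * c = Fract ([:-1, of_int v:] * p) 1"
    by (simp add: p)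
  moreover have "Polynomial.degree ([:-1, of_int v:] * p) \<le> Suc d"
    using degree_mult_le[of "[:-1, of_int v:]" p] degree_pCons_le[of "-1" "[:of_int v :: rat:]"] p(2) by simp
  moreover have "Polynomial.coeff ([:-1, of_int v:] * p) (Suc d) = of_int v * x"
    using p by (simp add: coeff_eq_0)
  ultimately show ?thesis
    unfolding lead_def by blast
qed

lemma span_above_mono:
  "\<lbrakk>is_partition lam; mu \<in> above lam; f \<in> sym.span (qfun ` above mu)\<rbrakk> \<Longrightarrow> f \<in> sym.span (qfun ` above lam)"
  using sym.span_mono[OF image_mono[OF above_mono]] by blast

text \<open>In the recursion \<open>row_Suc_strip\<close> the larger entry of each pair is made to
  grow, so every shift with r \<ge> 1 lands strictly higher in dominance. The unshifted terms r = 0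
  contribute scalars of lower degree in \<alpha>, and the factor \<alpha> v i - 1 multiplies the
  leading coefficient by v i. Shifting destroys the order of the entries, so the induction runs over
  all nonnegative vectors.\<close>

lemma row_strip_triangular:
  assumes "i < l" "\<And>j. j < l \<Longrightarrow> v j \<ge> 0" "sum_list (part l v) \<le> N"
  shows "\<exists>c. lead (Suc k) (of_int (v i) ^ Suc k) c \<and>
    row N k (strip N l v i) - const c * qz l v \<in> sym.span (qfun ` above (part l v))"
  using assms
proof (induction k arbitrary: v i)
  case (0 v i)
  have "nat (v i) \<le> N"
    using 0 member_le_sum[of i "{..<l}" "\<lambda>i. nat (v i)"] by (simp add: sum_list_part)
  then have "row N 0 (strip N l v i) = const (alpha * of_int (v i)) * qz l v"
    using 0 by (intro row_0_strip) auto
  moreover have "lead (Suc 0) (of_int (v i) ^ Suc 0) (alpha * of_int (v i))"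
    unfolding lead_def by (rule exI[of _ "[:0, of_int (v i):]"]) (simp add: alpha_of_int_eq_Fract One_nat_def)
  ultimately show ?case
    by (intro exI[of _ "alpha * of_int (v i)"]) (simp add: sym.span_zero)
next
  case (Suc k v i)
  let ?S = "sym.span (qfun ` above (part l v))"
  define hi where "hi j = (if v j \<le> v i then i else j)" for j
  define lo where "lo j = (if v j \<le> v i then j else i)" for j
  have "\<forall>j. \<exists>c. j < l \<longrightarrow> lead (Suc k) (of_int (v j) ^ Suc k) c \<and> row N k (strip N l v j) - const c * qz l v \<in> ?S"
    using Suc by blast
  then obtain c where c: "\<And>j. j < l \<Longrightarrow> lead (Suc k) (of_int (v j) ^ Suc k) (c j)"
    "\<And>j. j < l \<Longrightarrow> row N k (strip N l v j) - const (c j) * qz l v \<in> ?S"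
    by metis
  have higher: "row N k (strip N l (shift a b r v) i') \<in> ?S"
    if "a < l" "b < l" "a \<noteq> b" "v b \<le> v a" "r \<ge> 1" "int r \<le> v b" "i' < l" for a b r i'
  proof -
    let ?w = "shift a b r v"
    have above: "part l ?w \<in> above (part l v)"
      using that by (intro part_shift_in_above)
    have w: "?w j \<ge> 0" if "j < l" for j
      using Suc.prems(2)[OF \<open>j < l\<close>] \<open>v b \<le> v a\<close> \<open>int r \<le> v b\<close> by (auto simp: shift_def)
    have "sum_list (part l ?w) \<le> N"
      using that Suc.prems by (subst sum_list_part_shift) auto
    with Suc.IH[of i' ?w] \<open>i' < l\<close> w obtain d where
      d: "row N k (strip N l ?w i') - const d * qz l ?w \<in> sym.span (qfun ` above (part l ?w))"
      by blast
    from d above have "row N k (strip N l ?w i') - const d * qz l ?w \<in> ?S"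
      by (intro span_above_mono[OF _ above]) auto
    moreover have "const d * qz l ?w \<in> ?S"
      using above w by (simp add: qz_eq_qfun_part sym.span_scale sym.span_base)
    ultimately have "(row N k (strip N l ?w i') - const d * qz l ?w) + const d * qz l ?w \<in> ?S"
      by (rule sym.span_add)
    then show ?thesis
      by simp
  qed
  define d where "d = (alpha * of_int (v i) - 1) * c i - (\<Sum>j\<in>{..<l} - {i}. c (lo j))"
  have vi: "v i \<le> int N"
    using Suc.prems member_le_sum[of i "{..<l}" "\<lambda>i. nat (v i)"] by (simp add: sum_list_part)
  have hilo: "hi j < l" "lo j < l" "hi j \<noteq> lo j" "v (lo j) \<le> v (hi j)" "v (lo j) \<ge> 0"
    if "j \<in> {..<l} - {i}" for j
    using that Suc.prems(1,2) by (auto simp: hi_def lo_def)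
  \<comment> \<open>Each \<open>c (lo j)\<close> has degree at most k + 1, so its coefficient in
    degree k + 2 is zero.\<close>
  have "lead (Suc (Suc k)) (of_int (v i) * of_int (v i) ^ Suc k + - (\<Sum>j\<in>{..<l} - {i}. 0))
      ((alpha * of_int (v i) - 1) * c i + - (\<Sum>j\<in>{..<l} - {i}. c (lo j)))"
    using hilo by (intro lead_add lead_uminus lead_sum lead_linear_mult c Suc.prems) (blast intro: lead_Suc c)
  then have "lead (Suc (Suc k)) (of_int (v i) ^ Suc (Suc k)) d"
    by (simp add: d_def)
  moreover have "row N (Suc k) (strip N l v i) - const d * qz l v \<in> ?S"
  proof -
    let ?A = "\<lambda>j. \<Sum>r\<in>{1..nat (v (lo j))}. row N k (strip N l (shift (hi j) (lo j) r v) (hi j))"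
    let ?B = "\<lambda>j. \<Sum>r\<in>{1..nat (v (lo j))}. row N k (strip N l (shift (hi j) (lo j) r v) (lo j))"
    have AB: "?A j \<in> ?S" "?B j \<in> ?S" if "j \<in> {..<l} - {i}" for j
      using hilo[OF that] by (auto intro!: sym.span_sum higher)
    have "{0..n} = insert 0 {1..n}" for n :: nat
      by auto
    then have "(\<Sum>r\<in>{0..nat (v (lo j))}. row N k (strip N l (shift (hi j) (lo j) r v) (lo j))) =
        row N k (strip N l v (lo j)) + ?B j" for j
      by (simp add: shift_def)
    then have "row N (Suc k) (strip N l v i) = const (alpha * of_int (v i) - 1) * row N k (strip N l v i) +
       (\<Sum>j\<in>{..<l} - {i}. ?A j - (row N k (strip N l v (lo j)) + ?B j))"
      using Suc.prems vi by (subst row_Suc_strip[where hi = hi and lo = lo]) (auto simp: hi_def lo_def)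
    also have "\<dots> = const d * qz l v +
       (const (alpha * of_int (v i) - 1) * (row N k (strip N l v i) - const (c i) * qz l v) +
       (\<Sum>j\<in>{..<l} - {i}. ?A j - ((row N k (strip N l v (lo j)) - const (c (lo j)) * qz l v) + ?B j)))"
    proof -
      have regroup: "A - ((X - y) + B) = (A - (X + B)) + y" for A B X y :: Sym
        by (simp add: algebra_simps)
      have combine: "u * X + S = (u * w - t) * Q + (u * (X - w * Q) + (S + t * Q))" for u w t X S Q :: Sym
        by (simp add: algebra_simps)
      have "const d = const (alpha * of_int (v i) - 1) * const (c i) - (\<Sum>j\<in>{..<l} - {i}. const (c (lo j)))"
        by (simp only: d_def const_diff const_mult const_sum)
      then show ?thesis
        by (simp only: regroup sum.distrib sum_distrib_right[symmetric]) (rule combine)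
    qed
    finally have "row N (Suc k) (strip N l v i) - const d * qz l v =
       const (alpha * of_int (v i) - 1) * (row N k (strip N l v i) - const (c i) * qz l v) +
       (\<Sum>j\<in>{..<l} - {i}. ?A j - ((row N k (strip N l v (lo j)) - const (c (lo j)) * qz l v) + ?B j))"
      by simp
    also have "\<dots> \<in> ?S"
      by (rule sym.span_add[OF sym.span_scale[OF c(2)[OF Suc.prems(1)]] sym.span_sum])
         (rule sym.span_diff[OF AB(1) sym.span_add[OF c(2)[OF hilo(2)] AB(2)]])
    finally show ?thesis .
  qed
  ultimately show ?case
    by blast
qed

lemma ham_triangular:
  assumes lam: "is_partition lam" and N: "sum_list lam \<le> N"
  shows "\<exists>c. lead (Suc k) (of_nat (\<Sum>x\<leftarrow>lam. x ^ Suc k)) c \<and>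
    ham N k (qfun lam) - const c * qfun lam \<in> sym.span (qfun ` above lam)"
proof -
  let ?l = "length lam" and ?v = "\<lambda>i. int (lam ! i)"
  have "\<forall>i. \<exists>c. i < ?l \<longrightarrow> lead (Suc k) (of_int (?v i) ^ Suc k) c \<and>
    row N k (strip N ?l ?v i) - const c * qfun lam \<in> sym.span (qfun ` above lam)"
    using row_strip_triangular[of _ ?l ?v N k] by (metis qfun_eq_qz N lam of_nat_0_le_iff part_nth)
  then obtain c where c: "\<And>i. i < ?l \<Longrightarrow> lead (Suc k) (of_int (?v i) ^ Suc k) (c i)"
    "\<And>i. i < ?l \<Longrightarrow> row N k (strip N ?l ?v i) - const (c i) * qfun lam \<in> sym.span (qfun ` above lam)"
    by metis
  have "lead (Suc k) (\<Sum>i<?l. of_int (?v i) ^ Suc k) (\<Sum>i<?l. c i)"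
    by (intro lead_sum c) auto
  moreover have "(\<Sum>i<?l. of_int (?v i) ^ Suc k) = (of_nat (\<Sum>x\<leftarrow>lam. x ^ Suc k) :: rat)"
    by (simp add: sum_list_sum_nth atLeast0LessThan)
  moreover have "ham N k (qfun lam) - const (\<Sum>i<?l. c i) * qfun lam =
      (\<Sum>i<?l. row N k (strip N ?l ?v i) - const (c i) * qfun lam)"
    by (simp add: ham_def qfun_eq_qz column_qz row_sum sum_subtractf const_sum sum_distrib_right)
  ultimately show ?thesis
    using c(2) by (metis (no_types, lifting) lessThan_iff sym.span_sum)
qed

section \<open>Power sums that determine a partition\<close>

lemma Suc_power_ge: "y ^ Suc k + Suc k * y ^ k \<le> Suc y ^ Suc k"
proof (induction k)
  case (Suc k)
  have "y ^ Suc (Suc k) + Suc (Suc k) * y ^ Suc k \<le> Suc y * (y ^ Suc k + Suc k * y ^ k)"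
    by (simp add: algebra_simps)
  also have "\<dots> \<le> Suc y * Suc y ^ Suc k"
    by (intro mult_left_mono Suc) simp
  finally show ?case
    by simp
qed simp

text \<open>Origin of the exponent: by \<open>Suc_power_ge\<close> the power of y + 1 is at least (y
  + n^2 + 1) y^(n^2), and n y \<le> n^2. So n parts of size at most y cannot outweigh a single part
  y + 1.\<close>

lemma power_gap:
  assumes "y \<le> n"
  shows "n * y ^ Suc (n * n) < Suc y ^ Suc (n * n)"
proof (cases "y = 0")
  case False
  have "n * y \<le> n * n"
    using assms by simp
  then have "n * y < y + Suc (n * n)"
    by linarith
  then have "n * y * y ^ (n * n) < (y + Suc (n * n)) * y ^ (n * n)"
    by (rule mult_strict_right_mono) (use False in simp)
  also have "\<dots> = y ^ Suc (n * n) + Suc (n * n) * y ^ (n * n)"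
    by (simp add: algebra_simps)
  also have "\<dots> \<le> Suc y ^ Suc (n * n)"
    by (rule Suc_power_ge)
  finally show ?thesis
    by (simp add: mult_ac)
qed simp

text \<open>The largest part at which two partitions differ dominates the rest.\<close>
lemma power_sums_separate:
  assumes "sorted_wrt (\<ge>) xs" "sorted_wrt (\<ge>) ys" "0 \<notin> set xs" "0 \<notin> set ys"
    "length xs \<le> n" "length ys \<le> n" "set xs \<subseteq> {..n}" "set ys \<subseteq> {..n}"
    "(\<Sum>x\<leftarrow>xs. x ^ Suc (n * n)) = (\<Sum>x\<leftarrow>ys. x ^ Suc (n * n))"
  shows "xs = ys"
  using assms
proof (induction xs arbitrary: ys)
  case Nil
  then show ?case
    by (cases ys) auto
next
  case (Cons x xs)
  let ?k = "Suc (n * n)"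
  obtain y ys' where ys: "ys = y # ys'"
    using Cons.prems by (cases ys) auto
  have less: "(\<Sum>x\<leftarrow>bs. x ^ ?k) < a ^ ?k" if "length bs \<le> n" "\<And>b. b \<in> set bs \<Longrightarrow> b < a" "a \<le> n" "a \<noteq> 0" for a bs
  proof -
    have "(\<Sum>x\<leftarrow>bs. x ^ ?k) \<le> (\<Sum>x\<leftarrow>bs. (a - 1) ^ ?k)"
      by (intro sum_list_mono power_mono) (use that(2) in force)+
    also have "\<dots> \<le> n * (a - 1) ^ ?k"
      using that(1) by (simp add: sum_list_triv mult_le_mono1)
    also have "\<dots> < Suc (a - 1) ^ ?k"
      using that by (intro power_gap) auto
    finally show ?thesis
      using that(4) by simp
  qed
  have "x = y"
  proof (rule ccontr)
    assume "x \<noteq> y"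
    then consider "y < x" | "x < y"
      by linarith
    then show False
    proof cases
      case 1
      then have "(\<Sum>x\<leftarrow>ys. x ^ ?k) < x ^ ?k"
        using Cons.prems ys by (intro less) auto
      with Cons.prems(9) show False
        by simp
    next
      case 2
      then have "(\<Sum>x\<leftarrow>x # xs. x ^ ?k) < y ^ ?k"
        using Cons.prems ys by (intro less) auto
      with Cons.prems(9) show False
        by (simp add: ys)
    qed
  qed
  with Cons.prems Cons.IH[of ys'] show ?case
    by (simp add: ys)
qed

lemma inj_on_power_sums: "inj_on (\<lambda>lam. \<Sum>x\<leftarrow>lam. x ^ Suc (n * n)) (partitions_of n)"
proof (rule inj_onI)
  fix xs ys assume *: "xs \<in> partitions_of n" "ys \<in> partitions_of n"
    "(\<Sum>x\<leftarrow>xs. x ^ Suc (n * n)) = (\<Sum>x\<leftarrow>ys. x ^ Suc (n * n))"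
  have len: "length zs \<le> sum_list zs" if "0 \<notin> set zs" for zs :: "nat list"
    using that by (induction zs) (auto simp: Suc_le_eq add_strict_increasing)
  then show "xs = ys"
    using * member_le_sum_list[of _ xs] member_le_sum_list[of _ ys] len[of xs] len[of ys]
    by (intro power_sums_separate[of xs ys n]) (auto simp: partitions_of_def is_partition_def)
qed

text \<open>The constant coefficients of the two polynomials in \<alpha> are compared.\<close>

lemma alpha_mult_of_int_eq_of_int: "alpha * of_int x = of_int y \<Longrightarrow> y = 0"
  by (simp add: alpha_of_int_eq_Fract of_int_eq_Fract[of y] eq_fract)

text \<open>The \<alpha>-free part of e' is - \<open>nstat\<close>, which differs for comparable
  partitions. This makes the denominator of the recursion nonzero.\<close>

lemma eprime_neq:
  assumes "is_partition lam" "mu \<in> above lam"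
  shows "eprime lam \<noteq> eprime mu"
proof
  assume eq: "eprime lam = eprime mu"
  define A where "A xs = (\<Sum>i<length xs. (xs ! i)^2)" for xs :: "nat list"
  have e: "2 * eprime xs = alpha * of_nat (A xs) - 2 * of_nat (nstat xs)" for xs
    by (simp add: eprime_def A_def nstat_def)
  have "alpha * of_int (int (A lam) - int (A mu)) = of_int (2 * int (nstat lam) - 2 * int (nstat mu))"
    using e[of lam] e[of mu] eq by (simp add: algebra_simps)
  then have "nstat lam = nstat mu"
    using alpha_mult_of_int_eq_of_int by fastforce
  with nstat_less[OF assms] show False
    by simp
qed

section \<open>Jack functions\<close>

lemma inner_span_eq_0:
  assumes "\<And>x. x \<in> X \<Longrightarrow> inner f x = 0" and "y \<in> sym.span X"
  shows "inner f y = 0"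
  using assms(2) by (induction rule: sym.span_induct_alt) (simp_all add: assms(1) inner_add_right inner_scale_right)

lemma qfun_notin_span_above: "is_partition lam \<Longrightarrow> qfun lam \<notin> sym.span (qfun ` above lam)"
proof
  assume lam: "is_partition lam" and span: "qfun lam \<in> sym.span (qfun ` above lam)"
  let ?P = "partitions_of (sum_list lam)"
  have mem: "lam \<in> ?P"
    using lam by (simp add: partitions_of_def)
  have "qfun ` above lam \<subseteq> qfun ` ?P - {qfun lam}"
    using above_subset_partitions_of[of lam] inj_onD[OF qfun_inj_on _ _ mem] by (auto simp: above_def)
  then have "sym.dependent (qfun ` ?P)"
    unfolding sym.dependent_def using span mem sym.span_mono by blast
  then obtain u f where f: "f \<in> qfun ` ?P" "u f \<noteq> 0" "(\<Sum>f\<in>qfun ` ?P. const (u f) * f) = 0"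
    by (auto simp: sym.dependent_finite)
  then have "(\<Sum>mu\<in>?P. const (u (qfun mu)) * qfun mu) = 0"
    by (simp add: sum.reindex[OF qfun_inj_on])
  with f(1,2) qfun_independent[of "\<lambda>mu. u (qfun mu)"] show False
    by auto
qed

section \<open>Triangular operators and their eigenvectors\<close>

definition qtriangular :: "nat list set \<Rightarrow> (nat list \<Rightarrow> F) \<Rightarrow> (Sym \<Rightarrow> Sym) \<Rightarrow> bool" where
  "qtriangular A eps H \<longleftrightarrow> (\<forall>lam\<in>A. H (qfun lam) - const (eps lam) * qfun lam \<in> sym.span (qfun ` above lam))"

definition qunitriangular :: "nat list set \<Rightarrow> (nat list \<Rightarrow> Sym) \<Rightarrow> bool" where
  "qunitriangular A R \<longleftrightarrow> (\<forall>lam\<in>A. R lam - qfun lam \<in> sym.span (qfun ` above lam))"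

definition upper_set :: "nat list set \<Rightarrow> bool" where
  "upper_set A \<longleftrightarrow> (\<forall>lam\<in>A. is_partition lam \<and> above lam \<subseteq> A)"

lemma is_partition_above: "mu \<in> above lam \<Longrightarrow> is_partition mu"
  by (simp add: above_def)

lemma upper_set_above: "is_partition lam \<Longrightarrow> upper_set (above lam)"
  unfolding upper_set_def using above_mono is_partition_above by blast

lemma upper_set_insert_above: "is_partition lam \<Longrightarrow> upper_set (insert lam (above lam))"
  using upper_set_above[of lam] by (auto simp: upper_set_def)

lemma upper_set_partitions_of: "upper_set (partitions_of n)"
  using above_subset_partitions_of by (auto simp: upper_set_def partitions_of_def)

text \<open>A unitriangular change of family is invertible: descending from the top of the dominance
  order, each \<open>qfun mu\<close> equals \<open>R mu\<close> up to terms already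
  obtained.\<close>

lemma span_qunitriangular:
  assumes A: "upper_set A" and R: "qunitriangular A R"
  shows "sym.span (R ` A) = sym.span (qfun ` A)"
proof -
  have diff: "R mu - qfun mu \<in> sym.span (qfun ` above mu)" if "mu \<in> A" for mu
    using R that by (auto simp: qunitriangular_def)
  have q: "qfun mu \<in> sym.span (R ` A)" if "mu \<in> A" for mu
    using that
  proof (induction "nstat mu" arbitrary: mu rule: less_induct)
    case less
    have "qfun ` above mu \<subseteq> sym.span (R ` A)"
      using less A nstat_less by (fastforce simp: upper_set_def)
    then have "sym.span (qfun ` above mu) \<subseteq> sym.span (R ` A)"
      by (simp add: sym.span_minimal sym.subspace_span)
    then have "R mu - qfun mu \<in> sym.span (R ` A)"
      using diff[OF less.prems] by blast
    with sym.span_base[OF imageI[OF less.prems]] have "R mu - (R mu - qfun mu) \<in> sym.span (R ` A)"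
      by (rule sym.span_diff)
    then show ?case
      by simp
  qed
  have "R mu \<in> sym.span (qfun ` A)" if "mu \<in> A" for mu
  proof -
    have "sym.span (qfun ` above mu) \<subseteq> sym.span (qfun ` A)"
      using A that by (intro sym.span_mono image_mono) (auto simp: upper_set_def)
    then have "(R mu - qfun mu) + qfun mu \<in> sym.span (qfun ` A)"
      by (intro sym.span_add[OF _ sym.span_base]) (use diff[OF that] that in auto)
    then show ?thesis
      by simp
  qed
  with q show ?thesis
    by (intro equalityI sym.span_minimal sym.subspace_span) auto
qed

text \<open>On the span of the functions above \<open>lam\<close> the eigenvectors already found
  diagonalize H with eigenvalues other than \<open>eps lam\<close>. Hence H - \<open>eps lam\<close>
  is onto there, and a preimage of the error term is subtracted from
  \<open>qfun lam\<close>.\<close>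

lemma eigenvectors_exist:
  assumes add: "\<And>f g. H (f + g) = H f + H g" and scale: "\<And>c f. H (const c * f) = const c * H f"
    and tri: "qtriangular A eps H" and A: "upper_set A" and inj: "inj_on eps A"
  shows "\<exists>R. qunitriangular A R \<and> (\<forall>lam\<in>A. H (R lam) = const (eps lam) * R lam)"
proof -
  have diff: "H (f - g) = H f - H g" for f g
    using add[of "f - g" g] by simp
  have "\<exists>r. r - qfun lam \<in> sym.span (qfun ` above lam) \<and> H r = const (eps lam) * r" if "lam \<in> A" for lam
    using that
  proof (induction "nstat lam" arbitrary: lam rule: less_induct)
    case less
    have lam: "is_partition lam" "above lam \<subseteq> A"
      using less.prems A by (auto simp: upper_set_def)
    have "\<forall>mu\<in>above lam. \<exists>r. r - qfun mu \<in> sym.span (qfun ` above mu) \<and> H r = const (eps mu) * r"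
      using less.hyps nstat_less lam by blast
    then obtain R where R: "qunitriangular (above lam) R"
      and eig: "\<And>mu. mu \<in> above lam \<Longrightarrow> H (R mu) = const (eps mu) * R mu"
      unfolding qunitriangular_def by metis
    have span: "sym.span (R ` above lam) = sym.span (qfun ` above lam)"
      using R lam(1) by (intro span_qunitriangular upper_set_above)
    have "\<exists>g\<in>sym.span (R ` above lam). H g - const (eps lam) * g = f" if "f \<in> sym.span (R ` above lam)" for f
      using that
    proof (induction rule: sym.span_induct_alt)
      case base
      have "H 0 = 0"
        using scale[of 0 0] by simp
      then show ?case
        by (intro bexI[of _ 0]) (auto simp: sym.span_zero)
    next
      case (step c x y)
      then obtain mu g where mu: "mu \<in> above lam" "x = R mu"
        and g: "g \<in> sym.span (R ` above lam)" "H g - const (eps lam) * g = y"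
        by blast
      have ne: "eps mu - eps lam \<noteq> 0"
        using inj_onD[OF inj, of mu lam] mu(1) lam less.prems by (auto simp: above_def)
      define a where "a = c / (eps mu - eps lam)"
      have "H (const a * x + g) - const (eps lam) * (const a * x + g) =
          const (a * (eps mu - eps lam)) * x + y"
        using eig[OF mu(1)] mu(2) g(2)[symmetric]
        by (simp add: add scale const_mult const_diff algebra_simps)
      also have "a * (eps mu - eps lam) = c"
        using ne by (simp add: a_def)
      finally show ?case
        using g(1) mu by (intro bexI[of _ "const a * x + g"] sym.span_add sym.span_scale) (auto intro: sym.span_base)
    qed
    moreover have "H (qfun lam) - const (eps lam) * qfun lam \<in> sym.span (R ` above lam)"
      using tri less.prems by (simp add: span qtriangular_def)
    ultimately obtain g where g: "g \<in> sym.span (qfun ` above lam)"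
      "H g - const (eps lam) * g = H (qfun lam) - const (eps lam) * qfun lam"
      using span by metis
    have "H (qfun lam - g) = const (eps lam) * (qfun lam - g)"
      using g(2) by (simp add: diff algebra_simps)
    moreover have "(qfun lam - g) - qfun lam \<in> sym.span (qfun ` above lam)"
      using sym.span_neg[OF g(1)] by simp
    ultimately show ?case
      by blast
  qed
  then show ?thesis
    unfolding qunitriangular_def by metis
qed

lemma ham_add: "ham N k (f + g) = ham N k f + ham N k g"
  using ham_lincomb[where A = "UNIV :: bool set" and c = "\<lambda>_. 1" and g = "\<lambda>b. if b then f else g"]
  by (simp add: UNIV_bool add.commute)

lemma ham_scale: "ham N k (const c * f) = const c * ham N k f"
  using ham_lincomb[where A = "{()}" and c = "\<lambda>_. c" and g = "\<lambda>_. f"] by simp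

lemma orthogonal_family_of_degree:
  "\<exists>R. qunitriangular (partitions_of n) R \<and>
     (\<forall>lam\<in>partitions_of n. \<forall>mu\<in>partitions_of n. lam \<noteq> mu \<longrightarrow> inner (R lam) (R mu) = 0)"
proof -
  let ?P = "partitions_of n" and ?k = "n * n"
  have "\<forall>lam\<in>?P. \<exists>c. lead (Suc ?k) (of_nat (\<Sum>x\<leftarrow>lam. x ^ Suc ?k)) c \<and>
      ham n ?k (qfun lam) - const c * qfun lam \<in> sym.span (qfun ` above lam)"
    by (intro ballI ham_triangular) (auto simp: partitions_of_def)
  then obtain eps where lead: "\<And>lam. lam \<in> ?P \<Longrightarrow> lead (Suc ?k) (of_nat (\<Sum>x\<leftarrow>lam. x ^ Suc ?k)) (eps lam)"
    and tri: "qtriangular ?P eps (ham n ?k)"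
    unfolding qtriangular_def by metis
  have inj: "inj_on eps ?P"
  proof (rule inj_onI)
    fix lam mu assume *: "lam \<in> ?P" "mu \<in> ?P" "eps lam = eps mu"
    with lead[of lam] lead[of mu] have "(\<Sum>x\<leftarrow>lam. x ^ Suc ?k) = (\<Sum>x\<leftarrow>mu. x ^ Suc ?k)"
      by (metis lead_unique of_nat_eq_iff)
    with * show "lam = mu"
      using inj_onD[OF inj_on_power_sums] by blast
  qed
  obtain R where R: "qunitriangular ?P R" "\<And>lam. lam \<in> ?P \<Longrightarrow> ham n ?k (R lam) = const (eps lam) * R lam"
    using eigenvectors_exist[OF ham_add ham_scale tri upper_set_partitions_of inj] by auto
  have "inner (R lam) (R mu) = 0" if "lam \<in> ?P" "mu \<in> ?P" "lam \<noteq> mu" for lam mu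
  proof -
    have "eps lam * inner (R lam) (R mu) = eps mu * inner (R lam) (R mu)"
      using ham_self_adjoint[of n ?k "R lam" "R mu"] R(2) that
      by (simp add: inner_scale_left inner_scale_right)
    moreover have "eps lam \<noteq> eps mu"
      using inj_onD[OF inj] that by blast
    ultimately show ?thesis
      by simp
  qed
  with R(1) show ?thesis
    by blast
qed

lemma qspan_above_subset: "sym.span (qfun ` above lam) \<subseteq> Lambda_deg (sum_list lam)"
  unfolding qspan_eq_Lambda_deg[symmetric]
  by (intro sym.span_mono image_mono above_subset_partitions_of)

lemma qunitriangular_Lambda_deg:
  assumes "qunitriangular A R" "lam \<in> A"
  shows "R lam \<in> Lambda_deg (sum_list lam)"
proof -
  have "(R lam - qfun lam) + qfun lam \<in> Lambda_deg (sum_list lam)"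
    using assms qspan_above_subset qfun_in_Lambda_deg
    by (intro sym.subspace_add[OF subspace_Lambda_deg]) (auto simp: qunitriangular_def)
  then show ?thesis
    by simp
qed

section \<open>The orthogonal family in all degrees\<close>

definition orthogonal_family :: "(nat list \<Rightarrow> Sym) \<Rightarrow> bool" where
  "orthogonal_family R \<longleftrightarrow> qunitriangular {lam. is_partition lam} R \<and>
     (\<forall>lam mu. is_partition lam \<longrightarrow> is_partition mu \<longrightarrow> lam \<noteq> mu \<longrightarrow> inner (R lam) (R mu) = 0)"

lemma orthogonal_family_exists: "\<exists>R. orthogonal_family R"
proof -
  obtain R where R: "\<And>n. qunitriangular (partitions_of n) (R n)"
    "\<And>n lam mu. lam \<in> partitions_of n \<Longrightarrow> mu \<in> partitions_of n \<Longrightarrow> lam \<noteq> mu \<Longrightarrow> inner (R n lam) (R n mu) = 0"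
    using orthogonal_family_of_degree by metis
  let ?R = "\<lambda>lam. R (sum_list lam) lam"
  have mem: "lam \<in> partitions_of (sum_list lam)" if "is_partition lam" for lam
    using that by (simp add: partitions_of_def)
  have "inner (?R lam) (?R mu) = 0" if "is_partition lam" "is_partition mu" "lam \<noteq> mu" for lam mu
  proof (cases "sum_list lam = sum_list mu")
    case True
    with that R(2)[of lam _ mu] mem show ?thesis
      by metis
  next
    case False
    then show ?thesis
      by (rule inner_Lambda_deg[OF qunitriangular_Lambda_deg[OF R(1) mem[OF that(1)]]
            qunitriangular_Lambda_deg[OF R(1) mem[OF that(2)]]])
  qed
  moreover have "qunitriangular {lam. is_partition lam} ?R"
    using R(1) mem by (auto simp: qunitriangular_def)
  ultimately have "orthogonal_family ?R"
    by (auto simp: orthogonal_family_def)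
  then show ?thesis
    by blast
qed

text \<open>By uniqueness of the Jack functions these are the \<open>Q\<^sub>\<lambda>\<close>, see \<open>jackQ_eq_oq\<close>.\<close>
definition oq :: "nat list \<Rightarrow> Sym" where
  "oq = (SOME R. orthogonal_family R)"

lemma orthogonal_family_oq: "orthogonal_family oq"
  unfolding oq_def using orthogonal_family_exists by (rule someI_ex)

lemma oq_orthogonal: "\<lbrakk>is_partition lam; is_partition mu; lam \<noteq> mu\<rbrakk> \<Longrightarrow> inner (oq lam) (oq mu) = 0"
  using orthogonal_family_oq unfolding orthogonal_family_def by blast

lemma oq_minus_qfun: "is_partition lam \<Longrightarrow> oq lam - qfun lam \<in> sym.span (qfun ` above lam)"
  using orthogonal_family_oq unfolding orthogonal_family_def qunitriangular_def by blast

lemma qunitriangular_oq: "upper_set A \<Longrightarrow> qunitriangular A oq"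
  unfolding qunitriangular_def upper_set_def using oq_minus_qfun by blast

lemma span_oq: "upper_set A \<Longrightarrow> sym.span (oq ` A) = sym.span (qfun ` A)"
  by (intro span_qunitriangular qunitriangular_oq)

lemma oq_Lambda_deg: "is_partition lam \<Longrightarrow> oq lam \<in> Lambda_deg (sum_list lam)"
  using qunitriangular_Lambda_deg[OF qunitriangular_oq[OF upper_set_insert_above], of lam lam] by simp

lemma inner_oq_self: "is_partition lam \<Longrightarrow> inner (oq lam) (oq lam) \<noteq> 0"
proof
  assume lam: "is_partition lam" and "inner (oq lam) (oq lam) = 0"
  then have "oq lam = 0"
    by (intro inner_self_eq_0 Lambda_deg_imp_in_Lambda[OF oq_Lambda_deg])
  then have "- qfun lam \<in> sym.span (qfun ` above lam)"
    using oq_minus_qfun[OF lam] by simp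
  with qfun_notin_span_above[OF lam] show False
    using sym.span_neg[of "- qfun lam"] by simp
qed

text \<open>The difference of \<open>oq mu\<close> and \<open>qfun mu\<close> is a combination of
  functions \<open>oq kap\<close> with \<open>kap\<close> above \<open>mu\<close>, and none of these
  is \<open>oq lam\<close>.\<close>

lemma inner_oq_qfun:
  assumes "is_partition lam" "is_partition mu" "lam \<notin> above mu"
  shows "inner (oq lam) (qfun mu) = inner (oq lam) (oq mu)"
proof -
  have "oq mu - qfun mu \<in> sym.span (oq ` above mu)"
    using oq_minus_qfun assms by (simp add: span_oq upper_set_above)
  then have "inner (oq lam) (oq mu - qfun mu) = 0"
    by (rule inner_span_eq_0[rotated]) (use assms in \<open>auto intro!: oq_orthogonal simp: above_def\<close>)
  then show ?thesis
    by (simp add: inner_diff_right)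
qed

text \<open>If Q = <P,P>^(-1) P, then <Q,Q> = <P,P>^(-1), so P is recovered as Q divided by its own
  square norm. The value 0 off partitions is the one that \<open>jack_family\<close>
  prescribes.\<close>

definition jP :: "nat list \<Rightarrow> Sym" where
  "jP lam = (if is_partition lam then const (inverse (inner (oq lam) (oq lam))) * oq lam else 0)"

lemma jP_Lambda_deg: "is_partition lam \<Longrightarrow> jP lam \<in> Lambda_deg (sum_list lam)"
  unfolding jP_def using sym.subspace_scale[OF subspace_Lambda_deg oq_Lambda_deg] by simp

lemma oq_eq_jP: "is_partition lam \<Longrightarrow> oq lam = const (inner (oq lam) (oq lam)) * jP lam"
  by (simp add: jP_def inner_oq_self flip: const_mult mult.assoc)

text \<open>Coefficients of monomial functions are scalar products with the functions
  \<open>qfun\<close>, so being orthogonal and triangular upwards in the latter means being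
  triangular downwards in the former.\<close>

lemma jack_family_jP: "jack_family jP"
proof -
  have "unitriangular (jP lam) lam" if lam: "is_partition lam" for lam
  proof -
    have Lam: "in_Lambda (jP lam)"
      by (rule Lambda_deg_imp_in_Lambda[OF jP_Lambda_deg[OF lam]])
    have m: "mcoeff (jP lam) mu = inverse (inner (oq lam) (oq lam)) * inner (oq lam) (qfun mu)" for mu
      unfolding mcoeff_eq_inner[OF Lam] using lam by (simp add: jP_def inner_scale_left)
    have "mcoeff (jP lam) lam = 1"
      unfolding m using lam inner_oq_self[OF lam] by (simp add: inner_oq_qfun above_def)
    moreover have "dominates lam mu" if "is_partition mu" "mu \<noteq> lam" "mcoeff (jP lam) mu \<noteq> 0" for mu
    proof (rule ccontr)
      assume "\<not> dominates lam mu"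
      then have "lam \<notin> above mu"
        by (simp add: above_def)
      with lam that show False
        by (simp add: m inner_oq_qfun oq_orthogonal)
    qed
    ultimately show ?thesis
      using Lam by (simp add: unitriangular_def)
  qed
  moreover have "inner (jP lam) (jP mu) = 0" if "is_partition lam" "is_partition mu" "lam \<noteq> mu" for lam mu
    using that by (simp add: jP_def inner_scale_left inner_scale_right oq_orthogonal)
  ultimately show ?thesis
    by (simp add: jack_family_def jP_def)
qed

text \<open>Homogeneity of a member of a Jack family has to be derived from its monomial
  coefficients. Each monomial p_\<mu> of another weight is a combination of functions
  \<open>qfun\<close> of that weight, so its coefficient in f vanishes.\<close>

lemma Lambda_degI:
  assumes "in_Lambda f" and "\<And>mu. is_partition mu \<Longrightarrow> sum_list mu \<noteq> n \<Longrightarrow> inner f (qfun mu) = 0"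
  shows "f \<in> Lambda_deg n"
proof -
  have "edeg e = n" if e: "e \<in> Poly_Mapping.keys f" for e
  proof (rule ccontr)
    assume ne: "edeg e \<noteq> n"
    have e0: "Poly_Mapping.lookup e 0 = 0"
      using e assms(1) by (auto simp: in_Lambda_def)
    then have "Poly_Mapping.single e 1 \<in> qspan (edeg e)"
      by (simp add: qspan_eq_Lambda_deg Lambda_deg_def Eset_def)
    then have "inner f (Poly_Mapping.single e 1) = 0"
      by (rule inner_span_eq_0[rotated]) (use assms(2) ne in \<open>auto simp: partitions_of_def\<close>)
    with e pnorm_pos[OF e0] show False
      by (auto simp: inner_single_right in_keys_iff)
  qed
  with assms(1) show ?thesis
    by (auto simp: Lambda_deg_def Eset_def in_Lambda_def)
qed

text \<open>The difference f of two candidates at \<open>lam\<close> pairs to zero with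
  \<open>qfun mu\<close> unless \<open>lam\<close> is above \<open>mu\<close>. If \<open>lam\<close>
  is above \<open>kap\<close>, both families agree at \<open>kap\<close> by induction, and
  orthogonality gives <f, \<open>oq kap\<close>> = 0. Otherwise \<open>oq kap\<close> is a
  combination of functions \<open>qfun mu\<close> that pair to zero with f. So f is orthogonal to a
  spanning set of its own degree, hence to itself.\<close>

lemma jack_family_unique:
  assumes P: "jack_family P"
  shows "P = jP"
proof
  fix lam
  show "P lam = jP lam"
  proof (cases "is_partition lam")
    case False
    with P show ?thesis
      by (simp add: jack_family_def jP_def)
  next
    case True
    define n where "n = sum_list lam"
    have "lam \<in> partitions_of n"
      using True by (simp add: n_def partitions_of_def)
    \<comment> \<open>The measure makes the induction climb from the bottom of the dominance order,
      where \<open>nstat\<close> is large.\<close>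
    then show ?thesis
    proof (induction "Max (nstat ` partitions_of n) - nstat lam" arbitrary: lam rule: less_induct)
      case (less lam)
      have lam: "is_partition lam" "sum_list lam = n"
        using less.prems by (auto simp: partitions_of_def)
      have tri: "in_Lambda (Q lam)" "inner (Q lam) (qfun lam) = 1"
          "\<And>mu. is_partition mu \<Longrightarrow> mu \<noteq> lam \<Longrightarrow> lam \<notin> above mu \<Longrightarrow> inner (Q lam) (qfun mu) = 0"
        if "jack_family Q" for Q
        using that lam unfolding jack_family_def unitriangular_def above_def
        by (auto simp flip: mcoeff_eq_inner)
      define f where "f = P lam - jP lam"
      have f_q: "inner f (qfun mu) = 0" if "is_partition mu" "lam \<notin> above mu" for mu
        unfolding f_def inner_diff_left using tri[OF P] tri[OF jack_family_jP] that
        by (cases "mu = lam") auto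
      have Lam: "in_Lambda f"
        using tri(1)[OF P] tri(1)[OF jack_family_jP] keys_diff[of "P lam" "jP lam"]
        unfolding f_def in_Lambda_def by blast
      have deg: "f \<in> Lambda_deg n"
        using lam by (intro Lambda_degI Lam f_q) (auto simp: above_def dominates_def)
      have "inner f (oq kap) = 0" if kap: "kap \<in> partitions_of n" for kap
      proof (cases "lam \<in> above kap")
        case True
        have part: "is_partition kap"
          using kap by (simp add: partitions_of_def)
        have "nstat lam < nstat kap"
          by (rule nstat_less[OF part True])
        moreover have "nstat kap \<le> Max (nstat ` partitions_of n)"
          using kap by (intro Max_ge) auto
        ultimately have "Max (nstat ` partitions_of n) - nstat kap < Max (nstat ` partitions_of n) - nstat lam"
          by linarith
        then have "P kap = jP kap"
          using kap by (rule less.hyps)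
        moreover have "lam \<noteq> kap"
          using True by (auto simp: above_def)
        ultimately have "inner f (jP kap) = 0"
          using P jack_family_jP part lam by (metis f_def inner_diff_left jack_family_def diff_self)
        then show ?thesis
          by (subst oq_eq_jP[OF part]) (simp add: inner_scale_right)
      next
        case False
        have part: "is_partition kap"
          using kap by (simp add: partitions_of_def)
        have up: "upper_set (insert kap (above kap))"
          using part by (rule upper_set_insert_above)
        have "oq kap \<in> sym.span (oq ` insert kap (above kap))"
          by (intro sym.span_base) auto
        then have "oq kap \<in> sym.span (qfun ` insert kap (above kap))"
          unfolding span_oq[OF up] .
        moreover have "inner f x = 0" if x: "x \<in> qfun ` insert kap (above kap)" for x
        proof -
          obtain mu where mu: "mu \<in> insert kap (above kap)" "x = qfun mu"
            using x by blast
          then have "is_partition mu"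
            using up by (auto simp: upper_set_def)
          moreover have "lam \<notin> above mu"
            using mu False above_trans[OF part] by blast
          ultimately show ?thesis
            using mu f_q by simp
        qed
        ultimately show ?thesis
          by (rule inner_span_eq_0[rotated])
      qed
      moreover have "f \<in> sym.span (oq ` partitions_of n)"
        using deg by (simp add: span_oq upper_set_partitions_of qspan_eq_Lambda_deg)
      ultimately have "inner f f = 0"
        by (intro inner_span_eq_0[of "oq ` partitions_of n" f f]) blast+
      then show ?case
        using inner_self_eq_0[OF Lam] by (simp add: f_def)
    qed
  qed
qed

lemma jackP_eq_jP: "jackP = jP"
  unfolding jackP_def by (rule the_equality[of jack_family, OF jack_family_jP jack_family_unique])

lemma jackQ_eq_oq: "is_partition lam \<Longrightarrow> jackQ lam = oq lam"
proof -
  assume lam: "is_partition lam"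
  define c where "c = inner (oq lam) (oq lam)"
  have "c \<noteq> 0"
    using lam by (simp add: c_def inner_oq_self)
  have jP: "jP lam = const (inverse c) * oq lam"
    using lam by (simp add: jP_def c_def)
  then have "inner (jP lam) (jP lam) = inverse c * (inverse c * c)"
    by (simp add: inner_scale_left inner_scale_right c_def)
  with \<open>c \<noteq> 0\<close> have inv: "inverse (inner (jP lam) (jP lam)) = c"
    by simp
  have "jackQ lam = const (inverse (inner (jP lam) (jP lam))) * jP lam"
    by (simp only: jackQ_def jackP_eq_jP)
  also have "\<dots> = const (c * inverse c) * oq lam"
    unfolding inv unfolding jP by (simp only: const_mult mult.assoc)
  finally show ?thesis
    using \<open>c \<noteq> 0\<close> by simp
qed

text \<open>No separation of eigenvalues is assumed, so this applies to \<open>H_1\<close>. By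
  triangularity f = H (\<open>oq lam\<close>) - \<open>eps lam\<close> \<open>oq lam\<close> lies in
  the span of the \<open>oq mu\<close> with \<open>mu\<close> above \<open>lam\<close>. Moving H to
  the other side turns <f, \<open>oq mu\<close>> into a pairing of \<open>oq lam\<close> with
  functions above \<open>mu\<close>, which vanishes. Thus f is orthogonal to itself.\<close>

lemma oq_eigenvector:
  assumes add: "\<And>f g. H (f + g) = H f + H g" and scale: "\<And>c f. H (const c * f) = const c * H f"
    and adj: "\<And>f g. inner (H f) g = inner f (H g)"
    and tri: "qtriangular (partitions_of n) eps H" and lam: "lam \<in> partitions_of n"
  shows "H (oq lam) = const (eps lam) * oq lam"
proof -
  have diff: "H (f - g) = H f - H g" for f g
    using add[of "f - g" g] by simp
  have zero: "H 0 = 0"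
    using scale[of 0 0] by simp
  have up: "H (oq mu) - const (eps mu) * oq mu \<in> sym.span (oq ` above mu)" if mu: "mu \<in> partitions_of n" for mu
  proof -
    have part: "is_partition mu"
      using mu by (simp add: partitions_of_def)
    let ?S = "sym.span (qfun ` above mu)"
    have H: "H g \<in> ?S" if "g \<in> ?S" for g
      using that
    proof (induction rule: sym.span_induct_alt)
      case (step c x y)
      then obtain kap where kap: "kap \<in> above mu" "x = qfun kap"
        by blast
      have "kap \<in> partitions_of n"
        using kap above_subset_partitions_of[of mu] mu by (auto simp: partitions_of_def)
      then have "H x - const (eps kap) * x \<in> ?S"
        using tri span_above_mono[OF part kap(1)] by (auto simp: qtriangular_def kap(2))
      then have "(H x - const (eps kap) * x) + const (eps kap) * x \<in> ?S"
        using kap by (intro sym.span_add sym.span_scale) (auto intro: sym.span_base)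
      with step show ?case
        by (simp add: add scale sym.span_add sym.span_scale)
    qed (simp add: zero sym.span_zero)
    define g where "g = oq mu - qfun mu"
    have g: "g \<in> ?S"
      using oq_minus_qfun[OF part] by (simp add: g_def)
    have "H (oq mu) - const (eps mu) * oq mu = (H (qfun mu) - const (eps mu) * qfun mu) + (H g - const (eps mu) * g)"
      by (simp add: g_def diff algebra_simps)
    also have "\<dots> \<in> ?S"
      using tri mu by (intro sym.span_add[OF _ sym.span_diff[OF H[OF g] sym.span_scale[OF g]]])
        (auto simp: qtriangular_def)
    finally show ?thesis
      by (simp add: span_oq upper_set_above part)
  qed
  have part: "is_partition lam"
    using lam by (simp add: partitions_of_def)
  define f where "f = H (oq lam) - const (eps lam) * oq lam"
  have "inner f (oq mu) = 0" if mu: "mu \<in> above lam" for mu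
  proof -
    have mu': "mu \<in> partitions_of n" "is_partition mu" "lam \<noteq> mu" "lam \<notin> insert mu (above mu)"
      using mu lam above_subset_partitions_of[of lam] above_trans[OF part mu, of lam]
      by (auto simp: partitions_of_def above_def)
    have "inner (oq lam) (H (oq mu) - const (eps mu) * oq mu) = 0"
      by (rule inner_span_eq_0[OF _ up[OF mu'(1)]])
         (use mu' part in \<open>auto intro!: oq_orthogonal simp: above_def\<close>)
    then show ?thesis
      using oq_orthogonal[OF part mu'(2,3)]
      by (simp add: f_def inner_diff_left inner_diff_right inner_scale_left inner_scale_right adj)
  qed
  then have "inner f f = 0"
    using up[OF lam] unfolding f_def[symmetric] by (intro inner_span_eq_0[of "oq ` above lam" f f]) blast+
  moreover have "in_Lambda f"
    using up[OF lam] qspan_above_subset[of lam] part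
    by (intro Lambda_deg_imp_in_Lambda[of _ "sum_list lam"]) (auto simp: f_def span_oq upper_set_above)
  ultimately show ?thesis
    using inner_self_eq_0[of f] by (simp add: f_def)
qed

section \<open>The recursion\<close>

text \<open>Triples are kept instead of resulting partitions, because equal parts let several
  triples have the same result; this multiplicity becomes a factor of \<open>rcoef\<close>.\<close>

definition moves :: "nat list \<Rightarrow> (nat \<times> nat \<times> nat) set" where
  "moves nu = {(i, j, k). valid_move i j k nu}"

lemma sum_moves:
  "(\<Sum>(i, j, k)\<in>moves nu. f i j k) = (\<Sum>j<length nu. \<Sum>i<j. \<Sum>k\<in>{1..nu ! j}. f i j k)"
proof -
  have "(\<Sum>j<length nu. \<Sum>i<j. \<Sum>k\<in>{1..nu ! j}. f i j k) =
      (\<Sum>(j, i, k)\<in>(SIGMA j:{..<length nu}. SIGMA i:{..<j}. {1..nu ! j}). f i j k)"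
    by (simp add: sum.Sigma)
  also have "\<dots> = (\<Sum>(i, j, k)\<in>moves nu. f i j k)"
    by (rule sum.reindex_bij_witness[of _ "\<lambda>(i, j, k). (j, i, k)" "\<lambda>(j, i, k). (i, j, k)"])
       (auto simp: moves_def valid_move_def)
  finally show ?thesis
    by simp
qed

lemma finite_moves [simp]: "finite (moves nu)"
proof (rule finite_subset)
  show "moves nu \<subseteq> {..<length nu} \<times> {..<length nu} \<times> {..sum_list nu}"
    using member_le_sum_list[of _ nu] by (force simp: moves_def valid_move_def in_set_conv_nth)
qed simp

lemma part_shift_eq_move:
  assumes "valid_move i j k lam"
  shows "part (length lam) (shift i j k (\<lambda>i. int (lam ! i))) = move i j k lam"
proof -
  have "map (\<lambda>m. nat (shift i j k (\<lambda>i. int (lam ! i)) m)) [0..<length lam] =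
      lam[i := lam ! i + k, j := lam ! j - k]"
    using assms by (intro nth_equalityI) (auto simp: shift_def valid_move_def nth_list_update nat_add_distrib nat_diff_distrib)
  then show ?thesis
    by (simp add: part_def move_def psort_def)
qed

lemma partition_nth_mono: "\<lbrakk>is_partition nu; i \<le> j; j < length nu\<rbrakk> \<Longrightarrow> nu ! j \<le> nu ! i"
  by (cases "i = j") (auto simp: is_partition_def sorted_wrt_iff_nth_less)

lemma move_in_above:
  assumes nu: "is_partition nu" and t: "valid_move i j k nu"
  shows "move i j k nu \<in> above nu"
proof -
  have "part (length nu) (shift i j k (\<lambda>i. int (nu ! i))) \<in> above (part (length nu) (\<lambda>i. int (nu ! i)))"
    using t partition_nth_mono[OF nu, of i j] by (intro part_shift_in_above) (auto simp: valid_move_def)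
  then show ?thesis
    by (simp add: part_shift_eq_move[OF t] part_nth[OF nu])
qed

text \<open>In \<open>H_1\<close> an unordered pair of positions appears twice, once for the strip
  of each position. The smaller position holds the larger part of a partition and is the one that
  grows.\<close>

lemma sum_min_max:
  fixes g :: "nat \<Rightarrow> nat \<Rightarrow> Sym"
  shows "(\<Sum>i<l. \<Sum>j\<in>{..<l} - {i}. g (min i j) (max i j)) = 2 * (\<Sum>j<l. \<Sum>i<j. g i j)"
proof -
  have "(\<Sum>j\<in>{..<l} - {i}. g (min i j) (max i j)) = (\<Sum>j<i. g j i) + (\<Sum>j | j \<in> {..<l} \<and> i < j. g i j)"
    if "i < l" for i
  proof -
    have "{..<l} - {i} = {..<i} \<union> {j \<in> {..<l}. i < j}"
      using that by auto
    moreover have "(\<Sum>j\<in>{..<i} \<union> {j \<in> {..<l}. i < j}. g (min i j) (max i j)) =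
        (\<Sum>j<i. g (min i j) (max i j)) + (\<Sum>j | j \<in> {..<l} \<and> i < j. g (min i j) (max i j))"
      by (rule sum.union_disjoint) auto
    ultimately have "(\<Sum>j\<in>{..<l} - {i}. g (min i j) (max i j)) =
        (\<Sum>j<i. g (min i j) (max i j)) + (\<Sum>j | j \<in> {..<l} \<and> i < j. g (min i j) (max i j))"
      by (simp only:)
    also have "\<dots> = (\<Sum>j<i. g j i) + (\<Sum>j | j \<in> {..<l} \<and> i < j. g i j)"
      by (intro arg_cong2[where f = "(+)"] sum.cong) auto
    finally show ?thesis .
  qed
  then have "(\<Sum>i<l. \<Sum>j\<in>{..<l} - {i}. g (min i j) (max i j)) =
      (\<Sum>i<l. \<Sum>j<i. g j i) + (\<Sum>i<l. \<Sum>j | j \<in> {..<l} \<and> i < j. g i j)"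
    by (simp add: sum.distrib)
  also have "(\<Sum>i<l. \<Sum>j | j \<in> {..<l} \<and> i < j. g i j) = (\<Sum>j<l. \<Sum>i | i \<in> {..<l} \<and> i < j. g i j)"
    by (rule sum.swap_restrict) auto
  also have "\<dots> = (\<Sum>j<l. \<Sum>i<j. g i j)"
    by (intro sum.cong) auto
  finally show ?thesis
    by simp
qed

text \<open>For a pair a < b, Newton's relation evaluates the two families of strips to \<alpha> (v
  a + r) and \<alpha> (v b - r); their difference is \<alpha> times the weight of the move. The term
  r = 0 of the second family stays unpaired and contributes - \<alpha> v b to the diagonal, once for
  each a < b, which produces the linear statistic in e'.\<close>

lemma ham_1_qfun:
  assumes lam: "is_partition lam" and N: "sum_list lam \<le> N"
  shows "ham N 1 (qfun lam) = const (2 * alpha) *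
    (const (eprime lam + of_nat (sum_list lam) / 2) * qfun lam +
     (\<Sum>(i, j, k)\<in>moves lam. const (of_nat (lam ! i) - of_nat (lam ! j) + 2 * of_nat k) * qfun (move i j k lam)))"
proof -
  define l where "l = length lam"
  define v where "v = (\<lambda>i. int (lam ! i))"
  have q: "qfun lam = qz l v"
    by (simp add: l_def v_def qfun_eq_qz)
  have sum: "sum_list lam = (\<Sum>i<l. lam ! i)"
    by (simp add: l_def sum_list_sum_nth atLeast0LessThan)
  have vN: "v i \<le> int N" if "i < l" for i
    using that N member_le_sum[of i "{..<l}" "\<lambda>i. lam ! i"] by (simp add: v_def sum)
  \<comment> \<open>A shift enlarges v a up to at most v a + v b, and Newton's relation must still
    be complete there.\<close>
  have vN2: "v i + v j \<le> int N" if "i < l" "j < l" "i \<noteq> j" for i j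
  proof -
    have "(\<Sum>m\<in>{i, j}. lam ! m) \<le> (\<Sum>m<l. lam ! m)"
      using that by (intro sum_mono2) auto
    with that N show ?thesis
      by (simp add: v_def sum)
  qed
  define T where "T a b = (\<Sum>r\<in>{1..nat (v b)}. const (of_nat (lam ! a) - of_nat (lam ! b) + 2 * of_nat r) * qfun (move a b r lam))" for a b
  have pair: "(\<Sum>r\<in>{1..nat (v b)}. row N 0 (strip N l (shift a b r v) a))
       - (\<Sum>r\<in>{0..nat (v b)}. row N 0 (strip N l (shift a b r v) b)) =
     const alpha * T a b - const (alpha * of_nat (lam ! b)) * qfun lam" (is "?A - ?B = _") if "a < b" "b < l" for a b
  proof -
    let ?q = "\<lambda>r. qfun (move a b r lam)"
    have qz: "qz l (shift a b r v) = ?q r" if "r \<in> {1..nat (v b)}" for r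
    proof -
      have "valid_move a b r lam"
        using that \<open>a < b\<close> \<open>b < l\<close> by (auto simp: valid_move_def l_def v_def)
      moreover have "qz l (shift a b r v) = qfun (part l (shift a b r v))"
        using that by (intro qz_eq_qfun_part) (auto simp: shift_def v_def)
      ultimately show ?thesis
        unfolding l_def v_def using part_shift_eq_move by metis
    qed
    have A: "row N 0 (strip N l (shift a b r v) a) = const (alpha * of_int (v a + int r)) * ?q r"
      if "r \<in> {1..nat (v b)}" for r
    proof -
      have "shift a b r v a = v a + int r" "v a + int r \<le> int N"
        using that vN2[of a b] \<open>a < b\<close> \<open>b < l\<close> by (auto simp: shift_def)
      then show ?thesis
        using row_0_strip[of a l "shift a b r v" N] qz[OF that] \<open>a < b\<close> \<open>b < l\<close> by simp
    qed
    have B: "row N 0 (strip N l (shift a b r v) b) = const (alpha * of_int (v b - int r)) * qz l (shift a b r v)" for r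
    proof -
      have "shift a b r v b = v b - int r" "v b - int r \<le> int N"
        using vN[OF \<open>b < l\<close>] by (auto simp: shift_def)
      then show ?thesis
        using row_0_strip[of b l "shift a b r v" N] \<open>b < l\<close> by simp
    qed
    have "{0..nat (v b)} = insert 0 {1..nat (v b)}"
      by auto
    then have "?B = const (alpha * of_int (v b)) * qz l v + (\<Sum>r\<in>{1..nat (v b)}. const (alpha * of_int (v b - int r)) * ?q r)"
      using qz by (simp add: B) (simp add: shift_def)
    moreover have "?A = (\<Sum>r\<in>{1..nat (v b)}. const (alpha * of_int (v a + int r)) * ?q r)"
      by (intro sum.cong refl A)
    moreover have "const (alpha * of_int (v a + int r)) * ?q r - const (alpha * of_int (v b - int r)) * ?q r =
        const alpha * (const (of_nat (lam ! a) - of_nat (lam ! b) + 2 * of_nat r) * ?q r)" for r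
    proof -
      have "alpha * of_int (v a + int r) - alpha * of_int (v b - int r) =
          alpha * (of_nat (lam ! a) - of_nat (lam ! b) + 2 * of_nat r)"
        by (simp add: v_def algebra_simps)
      then show ?thesis
        by (simp only: left_diff_distrib[symmetric] const_diff[symmetric] const_mult[symmetric] mult.assoc[symmetric])
    qed
    then have "(\<Sum>r\<in>{1..nat (v b)}. const (alpha * of_int (v a + int r)) * ?q r) -
        (\<Sum>r\<in>{1..nat (v b)}. const (alpha * of_int (v b - int r)) * ?q r) = const alpha * T a b"
      unfolding T_def sum_subtractf[symmetric] sum_distrib_left by (intro sum.cong refl)
    ultimately show ?thesis
      by (simp add: q v_def)
  qed
  have row: "row N (Suc 0) (strip N l v i) = const ((alpha * of_nat (lam ! i) - 1) * (alpha * of_nat (lam ! i))) * qfun lam +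
     (\<Sum>j\<in>{..<l} - {i}. const alpha * T (min i j) (max i j) - const (alpha * of_nat (lam ! max i j)) * qfun lam)"
    if i: "i < l" for i
  proof -
    have "row N (Suc 0) (strip N l v i) = const (alpha * of_int (v i) - 1) * row N 0 (strip N l v i) +
      (\<Sum>j\<in>{..<l} - {i}. (\<Sum>r\<in>{1..nat (v (max i j))}. row N 0 (strip N l (shift (min i j) (max i j) r v) (min i j)))
       - (\<Sum>r\<in>{0..nat (v (max i j))}. row N 0 (strip N l (shift (min i j) (max i j) r v) (max i j))))"
      using i vN[OF i] by (intro row_Suc_strip) (auto simp: v_def)
    also have "(\<Sum>j\<in>{..<l} - {i}. (\<Sum>r\<in>{1..nat (v (max i j))}. row N 0 (strip N l (shift (min i j) (max i j) r v) (min i j)))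
       - (\<Sum>r\<in>{0..nat (v (max i j))}. row N 0 (strip N l (shift (min i j) (max i j) r v) (max i j)))) =
      (\<Sum>j\<in>{..<l} - {i}. const alpha * T (min i j) (max i j) - const (alpha * of_nat (lam ! max i j)) * qfun lam)"
      using i by (intro sum.cong refl pair) auto
    also have "row N 0 (strip N l v i) = const (alpha * of_nat (lam ! i)) * qfun lam"
      using row_0_strip[where v = v, OF i vN[OF i]] by (simp add: q v_def)
    finally show ?thesis
      by (simp only: v_def const_mult mult.assoc of_int_of_nat_eq)
  qed
  have "ham N 1 (qfun lam) = (\<Sum>i<l. row N 1 (strip N l v i))"
    unfolding ham_def q column_qz by (rule row_sum)
  also have "\<dots> = (\<Sum>i<l. const ((alpha * of_nat (lam ! i) - 1) * (alpha * of_nat (lam ! i)))) * qfun lam +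
      (\<Sum>i<l. \<Sum>j\<in>{..<l} - {i}. const alpha * T (min i j) (max i j) - const (alpha * of_nat (lam ! max i j)) * qfun lam)"
    by (simp add: row sum.distrib sum_distrib_right)
  also have "(\<Sum>i<l. \<Sum>j\<in>{..<l} - {i}. const alpha * T (min i j) (max i j) - const (alpha * of_nat (lam ! max i j)) * qfun lam) =
      2 * (\<Sum>j<l. \<Sum>i<j. const alpha * T i j - const (alpha * of_nat (lam ! j)) * qfun lam)"
    by (rule sum_min_max)
  also have "(\<Sum>j<l. \<Sum>i<j. const alpha * T i j - const (alpha * of_nat (lam ! j)) * qfun lam) =
      const alpha * (\<Sum>j<l. \<Sum>i<j. T i j) - const (\<Sum>j<l. of_nat j * (alpha * of_nat (lam ! j))) * qfun lam"
    by (simp add: sum_subtractf sum_distrib_left sum_distrib_right const_sum const_mult const_of_nat mult.assoc)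
  also have "(\<Sum>j<l. \<Sum>i<j. T i j) =
     (\<Sum>(i, j, k)\<in>moves lam. const (of_nat (lam ! i) - of_nat (lam ! j) + 2 * of_nat k) * qfun (move i j k lam))" (is "_ = ?M")
    unfolding sum_moves by (simp add: T_def v_def l_def)
  finally have main: "ham N 1 (qfun lam) =
      (\<Sum>i<l. const ((alpha * of_nat (lam ! i) - 1) * (alpha * of_nat (lam ! i)))) * qfun lam +
      2 * (const alpha * ?M - const (\<Sum>j<l. of_nat j * (alpha * of_nat (lam ! j))) * qfun lam)" .
  \<comment> \<open>Positions are counted from 0 here, and \<open>eprime\<close> uses i + 1;
    together with the - 1 from \<alpha> v i - 1 this accounts for the shift by half the
    weight.\<close>
  have coeff: "(\<Sum>i<l. (alpha * of_nat (lam ! i) - 1) * (alpha * of_nat (lam ! i))) -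
      2 * (\<Sum>j<l. of_nat j * (alpha * of_nat (lam ! j))) = 2 * alpha * (eprime lam + of_nat (sum_list lam) / 2)"
  proof -
    have "2 * (eprime lam + of_nat (sum_list lam) / 2) =
        alpha * of_nat (\<Sum>i<l. (lam ! i)^2) - 2 * of_nat (\<Sum>i<l. (i + 1) * lam ! i) + of_nat (\<Sum>i<l. lam ! i)"
      unfolding eprime_def sum l_def[symmetric] by (simp add: distrib_left right_diff_distrib del: of_nat_sum)
    also have "\<dots> = (\<Sum>i<l. alpha * of_nat (lam ! i) ^ 2 - 2 * ((of_nat i + 1) * of_nat (lam ! i)) + of_nat (lam ! i))"
      by (simp only: sum_subtractf sum.distrib sum_distrib_left of_nat_sum of_nat_mult of_nat_add of_nat_power of_nat_1)
    finally have double: "2 * (eprime lam + of_nat (sum_list lam) / 2) =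
        (\<Sum>i<l. alpha * of_nat (lam ! i) ^ 2 - 2 * ((of_nat i + 1) * of_nat (lam ! i)) + of_nat (lam ! i))" .
    have "2 * alpha * (eprime lam + of_nat (sum_list lam) / 2) = alpha * (2 * (eprime lam + of_nat (sum_list lam) / 2))"
      by (simp only: mult_ac)
    also have "\<dots> =
        (\<Sum>i<l. alpha * (alpha * of_nat (lam ! i) ^ 2 - 2 * ((of_nat i + 1) * of_nat (lam ! i)) + of_nat (lam ! i)))"
      unfolding double by (rule sum_distrib_left)
    also have "\<dots> = (\<Sum>i<l. (alpha * of_nat (lam ! i) - 1) * (alpha * of_nat (lam ! i)) - 2 * (of_nat i * (alpha * of_nat (lam ! i))))"
      by (intro sum.cong refl) (simp add: algebra_simps power2_eq_square)
    also have "\<dots> = (\<Sum>i<l. (alpha * of_nat (lam ! i) - 1) * (alpha * of_nat (lam ! i))) -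
      2 * (\<Sum>j<l. of_nat j * (alpha * of_nat (lam ! j)))"
      by (simp add: sum_subtractf sum_distrib_left)
    finally show ?thesis
      by simp
  qed
  have two: "const 2 = 2"
    using const_of_nat[of 2] by simp
  have arrange: "u * Q + 2 * (c * M - w * Q) = 2 * c * M + (u - 2 * w) * Q" for u Q c M w :: Sym
    by (simp add: algebra_simps)
  have "ham N 1 (qfun lam) = const (2 * alpha) * ?M + const (2 * alpha * (eprime lam + of_nat (sum_list lam) / 2)) * qfun lam"
    unfolding main arrange coeff[symmetric] by (simp only: const_diff const_mult const_sum two)
  moreover have "d * (e * Q + M) = d * M + d * e * Q" for d e Q M :: Sym
    by (simp add: algebra_simps)
  ultimately show ?thesis
    by (simp only: const_mult[of "2 * alpha" "eprime lam + of_nat (sum_list lam) / 2"])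
qed

section \<open>Counting the moves with a given result\<close>

lemma mset_move:
  fixes xs :: "'a list"
  assumes "i < j" "j < length xs"
  shows "mset (xs[i := p, j := q]) + {#xs ! i, xs ! j#} = mset xs + {#p, q#}"
proof -
  have upd: "add_mset (ys ! m) (mset (ys[m := y])) = add_mset y (mset ys)" if "m < length ys" for ys :: "'a list" and m y
    using that by (simp add: mset_update add_mset_commute[of _ y])
  have "add_mset (xs ! j) (mset (xs[i := p, j := q])) = add_mset q (mset (xs[i := p]))"
    using upd[of j "xs[i := p]" q] assms by simp
  moreover have "add_mset (xs ! i) (mset (xs[i := p])) = add_mset p (mset xs)"
    using upd[of i xs p] assms by simp
  ultimately show ?thesis
    by (simp add: add_mset_commute)
qed

lemma move_eq_psort: "move i j k nu = psort (nu[i := nu ! i + k, j := nu ! j - k])"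
  by (simp add: move_def psort_def)

lemma move_cong:
  assumes "valid_move i j k nu" "valid_move i' j' k nu" "nu ! i = nu ! i'" "nu ! j = nu ! j'"
  shows "move i j k nu = move i' j' k nu"
proof -
  have "mset (nu[i := nu ! i + k, j := nu ! j - k]) = mset (nu[i' := nu ! i' + k, j' := nu ! j' - k])"
    using mset_move[of i j nu "nu ! i + k" "nu ! j - k"] mset_move[of i' j' nu "nu ! i' + k" "nu ! j' - k"] assms
    by (metis add_right_cancel valid_move_def)
  then show ?thesis
    unfolding move_eq_psort by (intro psort_eqI) simp
qed

text \<open>\<open>rcoef\<close> chooses some triple, so its value must not depend on the choice.
  Comparing multiplicities, {a + k, b - k, a', b'} and {a' + k', b' - k', a, b} agree up to zeros.
  The largest elements give a + k = a' + k', and then {a, b} and {a', b'} must coincide.\<close>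

lemma move_inj:
  assumes nu: "is_partition nu" and t: "valid_move i j k nu" and t': "valid_move i' j' k' nu"
    and eq: "move i j k nu = move i' j' k' nu"
  shows "nu ! i = nu ! i' \<and> nu ! j = nu ! j' \<and> k = k'"
proof -
  define a b a' b' where "a = nu ! i" and "b = nu ! j" and "a' = nu ! i'" and "b' = nu ! j'"
  let ?n = "\<lambda>x y. if x = y then 1 else 0 :: nat"
  have ord: "b \<le> a" "b' \<le> a'" "0 < k" "k \<le> b" "0 < k'" "k' \<le> b'"
    using t t' partition_nth_mono[OF nu, of i j] partition_nth_mono[OF nu, of i' j']
    by (auto simp: valid_move_def a_def b_def a'_def b'_def)
  have cnt: "?n (a + k) x + ?n (b - k) x + ?n a' x + ?n b' x = ?n (a' + k') x + ?n (b' - k') x + ?n a x + ?n b x"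
    if "x > 0" for x
  proof -
    have two: "count (A + {#p, q#}) x = count A x + (?n p x + ?n q x)" for A p q
      by simp
    have "count (mset (move i j k nu)) x = count (mset (nu[i := a + k, j := b - k])) x"
      using that by (simp add: move_eq_psort mset_psort a_def b_def)
    moreover have "count (mset (move i' j' k' nu)) x = count (mset (nu[i' := a' + k', j' := b' - k'])) x"
      using that by (simp add: move_eq_psort mset_psort a'_def b'_def)
    ultimately have L: "count (mset (nu[i := a + k, j := b - k])) x = count (mset (nu[i' := a' + k', j' := b' - k'])) x"
      by (simp only: eq)
    have "count (mset (nu[i := a + k, j := b - k]) + {#a, b#}) x = count (mset nu + {#a + k, b - k#}) x"
      using mset_move[of i j nu "a + k" "b - k"] t by (simp only: valid_move_def a_def b_def)
    moreover have "count (mset (nu[i' := a' + k', j' := b' - k']) + {#a', b'#}) x = count (mset nu + {#a' + k', b' - k'#}) x"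
      using mset_move[of i' j' nu "a' + k'" "b' - k'"] t' by (simp only: valid_move_def a'_def b'_def)
    moreover have "P + Q + A' + B' = P' + Q' + A + B" if "L + (A + B) = M + (P + Q)" "L + (A' + B') = M + (P' + Q')"
      for L M P Q A B P' Q' A' B' :: nat
      using that by linarith
    ultimately show ?thesis
      unfolding two L by blast
  qed
  \<comment> \<open>Zero is excluded because b - k = 0 disappears from the partition; the values to
    which this is applied are positive.\<close>
  have sub: "x = a' + k' \<or> x = b' - k' \<or> x = a \<or> x = b"
    if "x > 0" "x = a + k \<or> x = b - k \<or> x = a' \<or> x = b'" for x
  proof -
    have "?n (a + k) x + ?n (b - k) x + ?n a' x + ?n b' x > 0"
      using that(2) by (elim disjE) simp_all
    then have "?n (a' + k') x + ?n (b' - k') x + ?n a x + ?n b x > 0"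
      by (simp only: cnt[OF that(1)])
    then show ?thesis
      by (auto split: if_split_asm)
  qed
  have sub': "x = a + k \<or> x = b - k \<or> x = a' \<or> x = b'"
    if "x > 0" "x = a' + k' \<or> x = b' - k' \<or> x = a \<or> x = b" for x
  proof -
    have "?n (a' + k') x + ?n (b' - k') x + ?n a x + ?n b x > 0"
      using that(2) by (elim disjE) simp_all
    then have "?n (a + k) x + ?n (b - k) x + ?n a' x + ?n b' x > 0"
      by (simp only: cnt[OF that(1)])
    then show ?thesis
      by (auto split: if_split_asm)
  qed
  have "a + k = a' + k'"
    using sub[of "a + k"] sub'[of "a' + k'"] ord by linarith
  moreover have "a = a' \<or> a = b'"
    using sub'[of a] ord by linarith
  moreover have "b = a' \<or> b = b'"
    using sub'[of b] ord by linarith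
  moreover have "a' = a \<or> a' = b"
    using sub[of a'] ord by linarith
  moreover have "b' = a \<or> b' = b"
    using sub[of b'] ord by linarith
  ultimately have "a = a' \<and> b = b' \<and> k = k'"
    using ord by linarith
  then show ?thesis
    by (simp add: a_def b_def a'_def b'_def)
qed

lemma card_nth_eq: "card {i. i < length xs \<and> xs ! i = a} = mult a xs"
proof -
  have "mult a xs = length (filter ((=) a) xs)"
    by (simp add: Defs.mult_def count_list_eq_length_filter)
  also have "\<dots> = card {i. i < length xs \<and> a = xs ! i}"
    by (rule length_filter_conv_card)
  finally show ?thesis
    by (simp add: eq_commute)
qed

lemma card_ordered_pairs:
  fixes S :: "nat set"
  assumes "finite S"
  shows "card S * card S = 2 * card {(i, j). i \<in> S \<and> j \<in> S \<and> i < j} + card S"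
proof -
  let ?X = "{(i, j). i \<in> S \<and> j \<in> S \<and> i < j}"
  have fin: "finite ?X"
    by (rule finite_subset[of _ "S \<times> S"]) (use assms in auto)
  have "S \<times> S = (?X \<union> prod.swap ` ?X) \<union> (\<lambda>i. (i, i)) ` S"
    by (force simp: image_iff)
  then have "card (S \<times> S) = card (?X \<union> prod.swap ` ?X) + card ((\<lambda>i. (i, i)) ` S)"
    using fin assms by (simp only:) (rule card_Un_disjoint, auto)
  also have "card (?X \<union> prod.swap ` ?X) = card ?X + card (prod.swap ` ?X)"
    using fin by (intro card_Un_disjoint) auto
  also have "card (prod.swap ` ?X) = card ?X"
    by (intro card_image) (auto simp: inj_on_def)
  also have "card ((\<lambda>i. (i, i)) ` S) = card S"
    by (intro card_image) (auto simp: inj_on_def)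
  finally show ?thesis
    by (simp add: card_cartesian_product)
qed

text \<open>The multiplicity factor of \<open>rcoef\<close> counts pairs of positions. For a = b
  these are the m (m - 1) / 2 pairs within one block of equal parts; for b < a the order of the
  positions is forced by that of the parts, which leaves a full product.\<close>

lemma card_pairs_with_parts:
  assumes nu: "is_partition nu" and ab: "b \<le> a"
  shows "(of_nat (card {(i, j). i < j \<and> j < length nu \<and> nu ! i = a \<and> nu ! j = b}) :: F) =
    inverse (1 + of_nat (if a = b then 1 else 0)) * of_nat (mult a nu) * (of_nat (mult b nu) - of_nat (if a = b then 1 else 0))"
proof (cases "a = b")
  case True
  let ?S = "{i. i < length nu \<and> nu ! i = a}"
  have X: "{(i, j). i < j \<and> j < length nu \<and> nu ! i = a \<and> nu ! j = b} = {(i, j). i \<in> ?S \<and> j \<in> ?S \<and> i < j}"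
    using True by auto
  have sq: "mult a nu * mult a nu = 2 * card {(i, j). i < j \<and> j < length nu \<and> nu ! i = a \<and> nu ! j = b} + mult a nu"
    using card_ordered_pairs[of ?S] unfolding X card_nth_eq by simp
  have "(of_nat (mult a nu) * of_nat (mult a nu) :: F) =
      2 * of_nat (card {(i, j). i < j \<and> j < length nu \<and> nu ! i = a \<and> nu ! j = b}) + of_nat (mult a nu)"
    using arg_cong[OF sq, of "of_nat :: nat \<Rightarrow> F"] by (simp only: of_nat_add of_nat_mult of_nat_numeral)
  with True show ?thesis
    by (simp add: field_simps)
next
  case False
  have "{(i, j). i < j \<and> j < length nu \<and> nu ! i = a \<and> nu ! j = b} =
      {i. i < length nu \<and> nu ! i = a} \<times> {j. j < length nu \<and> nu ! j = b}"
    using False ab partition_nth_mono[OF nu] by (auto simp: not_less) (metis le_antisym not_less)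
  with False show ?thesis
    by (simp add: card_cartesian_product card_nth_eq)
qed

text \<open>All triples leading to \<open>mu\<close> share the same two parts and the same k, so the
  sum is their number times one common weight.\<close>

lemma sum_moves_eq_rcoef:
  assumes nu: "is_partition nu"
  shows "(\<Sum>(i, j, k)\<in>{(i, j, k)\<in>moves nu. move i j k nu = mu}. of_nat (nu ! i) - of_nat (nu ! j) + 2 * of_nat k)
    = (if mu \<in> Mup nu then rcoef nu mu else 0)"
proof (cases "mu \<in> Mup nu")
  case False
  then have none: "{(i, j, k)\<in>moves nu. move i j k nu = mu} = {}"
    by (auto simp: Mup_def moves_def)
  show ?thesis
    unfolding none using False by simp
next
  case True
  then obtain i j k where t: "valid_move i j k nu" and mu: "mu = move i j k nu"
    by (auto simp: Mup_def)
  define a b where "a = nu ! i" and "b = nu ! j"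
  let ?X = "{(i, j). i < j \<and> j < length nu \<and> nu ! i = a \<and> nu ! j = b}"
  have ab: "b \<le> a"
    using t partition_nth_mono[OF nu, of i j] by (auto simp: valid_move_def a_def b_def)
  have same: "nu ! i' = a \<and> nu ! j' = b \<and> k' = k" if "valid_move i' j' k' nu" "move i' j' k' nu = mu" for i' j' k'
    using move_inj[OF nu that(1) t] that(2) mu by (simp add: a_def b_def)
  have "rcoef nu mu = inverse (1 + of_nat (if a = b then 1 else 0 :: nat)) * of_nat (mult a nu) *
      (of_nat (mult b nu) - of_nat (if a = b then 1 else 0 :: nat)) * (of_nat a - of_nat b + 2 * of_nat k)" (is "_ = ?c")
    unfolding rcoef_def Let_def
  proof (rule some_equality)
    show "\<exists>i j k. valid_move i j k nu \<and> mu = move i j k nu \<and>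
      ?c = inverse (1 + of_nat (if nu ! i = nu ! j then 1 else 0 :: nat)) * of_nat (mult (nu ! i) nu) *
      (of_nat (mult (nu ! j) nu) - of_nat (if nu ! i = nu ! j then 1 else 0 :: nat)) *
      (of_nat (nu ! i) - of_nat (nu ! j) + 2 * of_nat k)"
      using t mu unfolding a_def b_def by blast
  qed (use same in blast)
  also have "\<dots> = of_nat (card ?X) * (of_nat a - of_nat b + 2 * of_nat k)"
    by (simp only: card_pairs_with_parts[OF nu ab])
  also have "\<dots> = (\<Sum>(i, j)\<in>?X. of_nat (nu ! i) - of_nat (nu ! j) + 2 * of_nat k)"
    by (simp add: case_prod_unfold)
  also have "\<dots> = (\<Sum>(i, j, k)\<in>{(i, j, k)\<in>moves nu. move i j k nu = mu}. of_nat (nu ! i) - of_nat (nu ! j) + 2 * of_nat k)"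
  proof -
    have "{(i, j, k)\<in>moves nu. move i j k nu = mu} = (\<lambda>(i, j). (i, j, k)) ` ?X"
    proof (intro equalityI subsetI)
      fix x assume "x \<in> (\<lambda>(i, j). (i, j, k)) ` ?X"
      then obtain i' j' where x: "x = (i', j', k)" "i' < j'" "j' < length nu" "nu ! i' = a" "nu ! j' = b"
        by auto
      have v: "valid_move i' j' k nu"
        using x t by (simp add: valid_move_def b_def)
      have "move i' j' k nu = mu"
        using move_cong[OF v t] x by (simp add: mu a_def b_def)
      with v show "x \<in> {(i, j, k)\<in>moves nu. move i j k nu = mu}"
        by (simp add: x moves_def)
    next
      fix x assume "x \<in> {(i, j, k)\<in>moves nu. move i j k nu = mu}"
      then obtain i' j' k' where x: "x = (i', j', k')" and v: "valid_move i' j' k' nu" "move i' j' k' nu = mu"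
        by (auto simp: moves_def)
      have "(i', j') \<in> ?X" "k' = k"
        using same[OF v] v(1) by (auto simp: valid_move_def)
      then show "x \<in> (\<lambda>(i, j). (i, j, k)) ` ?X"
        by (intro image_eqI[of _ _ "(i', j')"]) (simp_all add: x)
    qed
    moreover have "inj_on (\<lambda>(i, j). (i, j, k)) ?X"
      by (auto simp: inj_on_def)
    ultimately show ?thesis
      by (simp only: sum.reindex) (simp add: case_prod_unfold)
  qed
  finally show ?thesis
    using True by simp
qed

lemma ham_1_qfun_expansion:
  assumes nu: "nu \<in> partitions_of n"
  shows "ham n 1 (qfun nu) = (\<Sum>kap\<in>partitions_of n.
    const ((if kap = nu then 2 * alpha * (eprime nu + of_nat n / 2) else 0) +
      2 * alpha * (if kap \<in> Mup nu then rcoef nu kap else 0)) * qfun kap)"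
proof -
  let ?P = "partitions_of n"
  let ?w = "\<lambda>(i, j, k). of_nat (nu ! i) - of_nat (nu ! j) + 2 * of_nat k :: F"
  let ?m = "\<lambda>(i, j, k). move i j k nu"
  have part: "is_partition nu" "sum_list nu = n"
    using nu by (auto simp: partitions_of_def)
  have "?m ` moves nu \<subseteq> ?P"
    using move_in_above[OF part(1)] above_subset_partitions_of[of nu] part by (auto simp: moves_def)
  then have "(\<Sum>t\<in>moves nu. const (?w t) * qfun (?m t)) =
      (\<Sum>kap\<in>?P. \<Sum>t\<in>{t \<in> moves nu. ?m t = kap}. const (?w t) * qfun (?m t))"
    by (intro sum.group[symmetric]) auto
  also have "\<dots> = (\<Sum>kap\<in>?P. const (\<Sum>t\<in>{t \<in> moves nu. ?m t = kap}. ?w t) * qfun kap)"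
    by (intro sum.cong refl) (simp add: const_sum sum_distrib_right)
  also have "\<dots> = (\<Sum>kap\<in>?P. const (if kap \<in> Mup nu then rcoef nu kap else 0) * qfun kap)"
  proof (intro sum.cong refl)
    fix kap
    have "{t \<in> moves nu. ?m t = kap} = {(i, j, k)\<in>moves nu. move i j k nu = kap}"
      by auto
    then show "const (\<Sum>t\<in>{t \<in> moves nu. ?m t = kap}. ?w t) * qfun kap =
        const (if kap \<in> Mup nu then rcoef nu kap else 0) * qfun kap"
      by (simp only: sum_moves_eq_rcoef[OF part(1)])
  qed
  finally have moves: "(\<Sum>t\<in>moves nu. const (?w t) * qfun (?m t)) =
    (\<Sum>kap\<in>?P. const (if kap \<in> Mup nu then rcoef nu kap else 0) * qfun kap)" .
  have "ham n 1 (qfun nu) = const (2 * alpha) *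
    (const (eprime nu + of_nat n / 2) * qfun nu + (\<Sum>t\<in>moves nu. const (?w t) * qfun (?m t)))"
    using ham_1_qfun[OF part(1), of n] part(2) by (simp add: case_prod_unfold)
  also have "\<dots> = const (2 * alpha * (eprime nu + of_nat n / 2)) * qfun nu +
      (\<Sum>kap\<in>?P. const (2 * alpha * (if kap \<in> Mup nu then rcoef nu kap else 0)) * qfun kap)"
    unfolding moves distrib_left[of "const (2 * alpha)"] sum_distrib_left by (simp only: const_mult mult.assoc)
  also have "const (2 * alpha * (eprime nu + of_nat n / 2)) * qfun nu =
      (\<Sum>kap\<in>?P. const (if kap = nu then 2 * alpha * (eprime nu + of_nat n / 2) else 0) * qfun kap)"
    using nu by (simp add: if_distrib[of const] if_distrib[of "\<lambda>x. x * _"] cong: if_cong)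
  finally show ?thesis
    by (simp only: const_add distrib_right sum.distrib)
qed

theorem theorem5p10:
  fixes lam mu :: "nat list" and C :: "nat list \<Rightarrow> F"
  assumes "is_partition lam"
    and "jackQ lam = (\<Sum>nu\<in>{nu. is_partition nu \<and> dominates nu lam}. const (C nu) * qfun nu)"
    and "is_partition mu" and "dominates mu lam" and "mu \<noteq> lam"
  shows "C mu = (\<Sum>nu\<in>{nu\<in>Mdown mu. dominates nu lam}. C nu * rcoef nu mu)
                / (eprime lam - eprime mu)"
proof -
  define n where "n = sum_list lam"
  let ?P = "partitions_of n" and ?S = "{nu. is_partition nu \<and> dominates nu lam}"
  define eps where "eps nu = 2 * alpha * (eprime nu + of_nat n / 2)" for nu
  define r where "r nu kap = (if kap \<in> Mup nu then rcoef nu kap else 0)" for nu kap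
  \<comment> \<open>Extending the coefficients by zero lets all sums run over the partitions of n,
    where the functions \<open>qfun\<close> are independent.\<close>
  define c where "c nu = (if dominates nu lam then C nu else 0)" for nu
  have S: "?S \<subseteq> ?P"
    by (auto simp: partitions_of_def dominates_def n_def)
  have lam: "lam \<in> ?P" and mu: "mu \<in> ?P"
    using assms by (auto simp: partitions_of_def n_def dominates_def)
  have part: "is_partition nu" "sum_list nu = n" if "nu \<in> ?P" for nu
    using that by (auto simp: partitions_of_def)
  have ham: "ham n 1 (qfun nu) = (\<Sum>kap\<in>?P. const ((if kap = nu then eps nu else 0) + 2 * alpha * r nu kap) * qfun kap)"
    if "nu \<in> ?P" for nu
    unfolding eps_def r_def by (rule ham_1_qfun_expansion[OF that])
  have "qtriangular ?P eps (ham n 1)"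
    unfolding qtriangular_def
  proof
    fix nu assume nu: "nu \<in> ?P"
    let ?M = "\<Sum>(i, j, k)\<in>moves nu. const (of_nat (nu ! i) - of_nat (nu ! j) + 2 * of_nat k) * qfun (move i j k nu)"
    have "ham n 1 (qfun nu) = const (2 * alpha) * (const (eprime nu + of_nat n / 2) * qfun nu + ?M)"
      using ham_1_qfun[OF part(1)[OF nu], of n] by (simp only: part(2)[OF nu] order_refl simp_thms)
    also have "\<dots> = const (eps nu) * qfun nu + const (2 * alpha) * ?M"
      unfolding eps_def distrib_left[of "const (2 * alpha)"] const_mult[of "2 * alpha" "eprime nu + of_nat n / 2"]
        mult.assoc[of "const (2 * alpha)"] ..
    finally have "ham n 1 (qfun nu) - const (eps nu) * qfun nu = const (2 * alpha) * ?M"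
      by (simp only: add_diff_cancel_left')
    also have "\<dots> \<in> sym.span (qfun ` above nu)"
    proof (rule sym.span_scale[OF sym.span_sum])
      fix t assume "t \<in> moves nu"
      then obtain i j k where t: "t = (i, j, k)" "valid_move i j k nu"
        by (auto simp: moves_def)
      have "qfun (move i j k nu) \<in> sym.span (qfun ` above nu)"
        using move_in_above[OF part(1)[OF nu] t(2)] by (intro sym.span_base imageI)
      then show "(case t of (i, j, k) \<Rightarrow> const (of_nat (nu ! i) - of_nat (nu ! j) + 2 * of_nat k) * qfun (move i j k nu))
          \<in> sym.span (qfun ` above nu)"
        unfolding t(1) prod.case by (rule sym.span_scale)
    qed
    finally show "ham n 1 (qfun nu) - const (eps nu) * qfun nu \<in> sym.span (qfun ` above nu)" .
  qed
  then have eig: "ham n 1 (oq lam) = const (eps lam) * oq lam"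
    by (rule oq_eigenvector[OF ham_add ham_scale ham_self_adjoint _ lam])
  have oq: "oq lam = (\<Sum>nu\<in>?P. const (c nu) * qfun nu)"
    unfolding jackQ_eq_oq[OF assms(1), symmetric] assms(2)
    using S by (intro sum.mono_neutral_cong_left) (auto simp: c_def part)
  \<comment> \<open>The eigenvalue equation for \<open>oq lam\<close> is expanded in the functions
    \<open>qfun kap\<close>, so that coefficients can be compared at \<open>mu\<close>.\<close>
  have "(\<Sum>kap\<in>?P. const (\<Sum>nu\<in>?P. c nu * ((if kap = nu then eps nu else 0) + 2 * alpha * r nu kap)) * qfun kap) =
      (\<Sum>kap\<in>?P. \<Sum>nu\<in>?P. const (c nu) * (const ((if kap = nu then eps nu else 0) + 2 * alpha * r nu kap) * qfun kap))"
    by (simp only: const_sum const_mult sum_distrib_right mult.assoc)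
  also have "\<dots> = (\<Sum>nu\<in>?P. \<Sum>kap\<in>?P. const (c nu) * (const ((if kap = nu then eps nu else 0) + 2 * alpha * r nu kap) * qfun kap))"
    by (rule sum.swap)
  also have "\<dots> = ham n 1 (oq lam)"
    unfolding oq ham_lincomb by (intro sum.cong refl) (simp only: ham sum_distrib_left)
  also have "\<dots> = (\<Sum>kap\<in>?P. const (eps lam * c kap) * qfun kap)"
    unfolding eig unfolding oq by (simp only: sum_distrib_left const_mult mult.assoc)
  finally have "(\<Sum>kap\<in>?P. const ((\<Sum>nu\<in>?P. c nu * ((if kap = nu then eps nu else 0) + 2 * alpha * r nu kap)) - eps lam * c kap)
      * qfun kap) = 0"
    by (simp only: const_diff left_diff_distrib sum_subtractf) simp
  then have "(\<Sum>nu\<in>?P. c nu * ((if mu = nu then eps nu else 0) + 2 * alpha * r nu mu)) - eps lam * c mu = 0"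
    using mu by (rule qfun_independent)
  also have "(\<Sum>nu\<in>?P. c nu * ((if mu = nu then eps nu else 0) + 2 * alpha * r nu mu)) =
      (\<Sum>nu\<in>?P. if mu = nu then c nu * eps nu else 0) + 2 * alpha * (\<Sum>nu\<in>?P. c nu * r nu mu)"
    unfolding sum_distrib_left sum.distrib[symmetric] by (intro sum.cong) (auto simp: algebra_simps)
  also have "(\<Sum>nu\<in>?P. if mu = nu then c nu * eps nu else 0) = c mu * eps mu"
    using mu by simp
  \<comment> \<open>The shift n / 2 is common to both eigenvalues and cancels, since
    \<open>lam\<close> and \<open>mu\<close> have equal weight.\<close>
  finally have "2 * alpha * (\<Sum>nu\<in>?P. c nu * r nu mu) = 2 * alpha * ((eprime lam - eprime mu) * c mu)"
    by (simp add: eps_def algebra_simps)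
  then have "(\<Sum>nu\<in>?P. c nu * r nu mu) = (eprime lam - eprime mu) * c mu"
    by simp
  moreover have "(\<Sum>nu\<in>?P. c nu * r nu mu) = (\<Sum>nu\<in>{nu\<in>Mdown mu. dominates nu lam}. C nu * rcoef nu mu)"
    using S by (intro sum.mono_neutral_cong_right) (auto simp: c_def r_def Mdown_def part)
  moreover have "c mu = C mu"
    using assms(4) by (simp add: c_def)
  moreover have "eprime lam \<noteq> eprime mu"
    using assms by (intro eprime_neq) (auto simp: above_def)
  ultimately show ?thesis
    by (simp add: field_simps)
qed

end
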